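(* Let $G$ be a 4-connected graph with at least five vertices and let $\Omega$ be a biased graph with $F(\Omega)=M(G)$ (equality of matroids on the common ground set $E(G)=E(\Omega)$), where the underlying graph of $\Omega$ has no isolated vertices. Then either $\Omega$ is balanced with underlying graph $G$, or $\Omega$ is obtained from $G$ as a simple curling or a pinch.
   Context: Graphs are finite and may have loops and parallel edges. For a set $Y$ of edges of $H$, $H|Y$ is the subgraph with edge set $Y$ and no isolated vertices. $M(G)$ is the cycle matroid of $G$. A graph is 2-connected if it is connected and consists of a single block, where a loop is regarded as a block by itself. A 4-connected graph with at least five vertices is a loopless connected graph (parallel edges allowed) that cannot be disconnected by deleting at most three vertices. Biased graphs. A theta graph consists of two distinct vertices and three internally disjoint paths between them. A biased graph $\Omega=(\Gamma,\mathcal{B})$ is a graph $\Gamma$ (the underlying graph) with a collection $\mathcal{B}$ of cycles of $\Gamma$, called balanced, such that no theta subgraph contains exactly two balanced cycles. Other cycles are unbalanced. $\Omega$ is balanced if all cycles of $\Gamma$ are balanced. The frame matroid $F(\Omega)$ has ground set $E(\Gamma)$, and its circuits are the edge sets of: balanced cycles; two edge-disjoint unbalanced cycles meeting in exactly one vertex; two vertex-disjoint unbalanced cycles together with a path connecting them (meeting each cycle in exactly one vertex); theta subgraphs all of whose cycles are unbalanced. A signed graph is a biased graph whose edges can be labelled by $\pm1$ such that a cycle is balanced if and only if it contains an even number of edges labelled $-1$. Different labellings with the same balanced cycles represent the same biased graph. In the constructions below edges keep their names, and biased graphs are considered up to renaming vertices. Simple curling. Let $H$ be a 2-connected graph, $v\in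 V(H)$, and suppose there are distinct vertices $v_1,\dots,v_k$ and pairwise edge-disjoint connected subgraphs $H_1,\dots,H_k$ of $H$ such that $V(H_i)\cap V(H|(E(H)-E(H_i)))=\{v,v_i\}$ for each $i$, and every edge incident with $v$ is contained in some $H_i$. Let $\Omega$ be the signed graph obtained from $H$ by labelling all edges incident with $v$ by $-1$ and changing any such edge $e=uv$ with $e\in E(H_i)$ to $uv_i$ (a loop at $v_i$ if $u=v_i$), and keeping all other edges unchanged and labelled $1$ ($v$ is removed). Then $\Omega$ is a curling of $H$; it is a simple curling if, for every $i$, every edge of $H_i$ is between $v$ and $v_i$. Pinch. $\Omega$ is the signed graph obtained from $H$ by identifying two vertices $v_1,v_2$ to a new vertex $v$ and labelling all edges incident with $v_1$ by $-1$ and all other edges by $1$ (an edge $v_1v_2$ becomes an unbalanced loop at $v$). *)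

theory Defs
  imports Main
begin

section \<open>Graphs with loops and parallel edges\<close>

text \<open>
  The ends of an edge form a set with one element (a loop) or two elements.
  The value of \<open>ends\<close> outside \<open>edges\<close> is irrelevant.
\<close>

record ('v, 'e) mgraph =
  verts :: "'v set"
  edges :: "'e set"
  ends :: "'e \<Rightarrow> 'v set"

definition graph :: "('v, 'e) mgraph \<Rightarrow> bool" where
  "graph G \<longleftrightarrow> finite (verts G) \<and> finite (edges G) \<and>
     (\<forall>e\<in>edges G. ends G e \<subseteq> verts G \<and> (card (ends G e) = 1 \<or> card (ends G e) = 2))"

definition loopless :: "('v, 'e) mgraph \<Rightarrow> bool" where
  "loopless G \<longleftrightarrow> (\<forall>e\<in>edges G. card (ends G e) \<noteq> 1)"

definition no_isolated_verts :: "('v, 'e) mgraph \<Rightarrow> bool" where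
  "no_isolated_verts G \<longleftrightarrow> (\<forall>v\<in>verts G. \<exists>e\<in>edges G. v \<in> ends G e)"

definition subgraph :: "('v, 'e) mgraph \<Rightarrow> ('v, 'e) mgraph \<Rightarrow> bool" where
  "subgraph K G \<longleftrightarrow> graph K \<and> verts K \<subseteq> verts G \<and> edges K \<subseteq> edges G \<and>
     (\<forall>e\<in>edges K. ends K e = ends G e)"

definition restrict_edges :: "('v, 'e) mgraph \<Rightarrow> 'e set \<Rightarrow> ('v, 'e) mgraph" where
  "restrict_edges G Y = \<lparr>verts = (\<Union>e\<in>Y. ends G e), edges = Y, ends = ends G\<rparr>"

definition delete_verts :: "('v, 'e) mgraph \<Rightarrow> 'v set \<Rightarrow> ('v, 'e) mgraph" where
  "delete_verts G X =
     \<lparr>verts = verts G - X, edges = {e \<in> edges G. ends G e \<inter> X = {}}, ends = ends G\<rparr>"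

definition connected_graph :: "('v, 'e) mgraph \<Rightarrow> bool" where
  "connected_graph G \<longleftrightarrow> verts G \<noteq> {} \<and>
     (\<forall>u\<in>verts G. \<forall>w\<in>verts G. (u, w) \<in> {(x, y). \<exists>e\<in>edges G. ends G e = {x, y}}\<^sup>*)"

text \<open>
  A separation of a connected graph splits the edges into two nonempty parts that share exactly
  one vertex. With this notion of separation a loop is always a block by itself.
\<close>

definition nonseparable :: "('v, 'e) mgraph \<Rightarrow> bool" where
  "nonseparable G \<longleftrightarrow> connected_graph G \<and>
     \<not> (\<exists>A B. A \<noteq> {} \<and> B \<noteq> {} \<and> A \<inter> B = {} \<and> A \<union> B = edges G \<and>
          card (verts (restrict_edges G A) \<inter> verts (restrict_edges G B)) = 1)"

definition block_of :: "('v, 'e) mgraph \<Rightarrow> ('v, 'e) mgraph \<Rightarrow> bool" where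
  "block_of K G \<longleftrightarrow> subgraph K G \<and> nonseparable K \<and>
     (\<forall>L. subgraph L G \<and> nonseparable L \<and> subgraph K L \<longrightarrow> subgraph L K)"

definition two_connected :: "('v, 'e) mgraph \<Rightarrow> bool" where
  "two_connected G \<longleftrightarrow> graph G \<and> connected_graph G \<and> block_of G G"

definition four_connected_ge5 :: "('v, 'e) mgraph \<Rightarrow> bool" where
  "four_connected_ge5 G \<longleftrightarrow> graph G \<and> card (verts G) \<ge> 5 \<and> loopless G \<and> connected_graph G \<and>
     (\<forall>X. X \<subseteq> verts G \<and> card X \<le> 3 \<longrightarrow> connected_graph (delete_verts G X))"


section \<open>Paths, cycles and theta graphs\<close>

text \<open>
  Cycles, theta graphs and paths with at least one edge are represented by their edge sets; their
  vertex sets are recovered with \<open>restrict_edges\<close>.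
\<close>

definition path_between :: "('v, 'e) mgraph \<Rightarrow> 'v \<Rightarrow> 'v \<Rightarrow> 'e set \<Rightarrow> bool" where
  "path_between G x y P \<longleftrightarrow>
     (\<exists>vs es. es \<noteq> [] \<and> length vs = Suc (length es) \<and> distinct vs \<and>
        hd vs = x \<and> last vs = y \<and> P = set es \<and> P \<subseteq> edges G \<and>
        (\<forall>i<length es. ends G (es ! i) = {vs ! i, vs ! Suc i}))"

definition cycle :: "('v, 'e) mgraph \<Rightarrow> 'e set \<Rightarrow> bool" where
  "cycle G C \<longleftrightarrow>
     (\<exists>vs es. es \<noteq> [] \<and> length vs = length es \<and> distinct vs \<and> distinct es \<and>
        C = set es \<and> C \<subseteq> edges G \<and>
        (\<forall>i<length es. ends G (es ! i) = {vs ! i, vs ! (Suc i mod length es)}))"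

definition theta :: "('v, 'e) mgraph \<Rightarrow> 'e set \<Rightarrow> bool" where
  "theta G T \<longleftrightarrow>
     (\<exists>x y P Q R. x \<noteq> y \<and> path_between G x y P \<and> path_between G x y Q \<and> path_between G x y R \<and>
        P \<inter> Q = {} \<and> P \<inter> R = {} \<and> Q \<inter> R = {} \<and>
        verts (restrict_edges G P) \<inter> verts (restrict_edges G Q) = {x, y} \<and>
        verts (restrict_edges G P) \<inter> verts (restrict_edges G R) = {x, y} \<and>
        verts (restrict_edges G Q) \<inter> verts (restrict_edges G R) = {x, y} \<and>
        T = P \<union> Q \<union> R)"


section \<open>Biased graphs\<close>

record ('v, 'e) bgraph =
  ugraph :: "('v, 'e) mgraph"
  balanced_cycles :: "'e set set"

definition biased_graph :: "('v, 'e) bgraph \<Rightarrow> bool" where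
  "biased_graph \<Omega> \<longleftrightarrow> graph (ugraph \<Omega>) \<and> (\<forall>C\<in>balanced_cycles \<Omega>. cycle (ugraph \<Omega>) C) \<and>
     (\<forall>T. theta (ugraph \<Omega>) T \<longrightarrow> card {C \<in> balanced_cycles \<Omega>. C \<subseteq> T} \<noteq> 2)"

definition unbalanced_cycle :: "('v, 'e) bgraph \<Rightarrow> 'e set \<Rightarrow> bool" where
  "unbalanced_cycle \<Omega> C \<longleftrightarrow> cycle (ugraph \<Omega>) C \<and> C \<notin> balanced_cycles \<Omega>"

definition balanced :: "('v, 'e) bgraph \<Rightarrow> bool" where
  "balanced \<Omega> \<longleftrightarrow> (\<forall>C. cycle (ugraph \<Omega>) C \<longrightarrow> C \<in> balanced_cycles \<Omega>)"

text \<open>The signed graph on \<open>G\<close> in which exactly the edges in \<open>N\<close> are labelled \<open>-1\<close>.\<close>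

definition signed_graph :: "('v, 'e) mgraph \<Rightarrow> 'e set \<Rightarrow> ('v, 'e) bgraph" where
  "signed_graph G N =
     \<lparr>ugraph = G, balanced_cycles = {C. cycle G C \<and> even (card (C \<inter> N))}\<rparr>"

text \<open>Equality up to renaming vertices; edges keep their names.\<close>

definition same_graph :: "('v, 'e) mgraph \<Rightarrow> ('w, 'e) mgraph \<Rightarrow> bool" where
  "same_graph G H \<longleftrightarrow> edges G = edges H \<and>
     (\<exists>f. bij_betw f (verts G) (verts H) \<and> (\<forall>e\<in>edges G. ends H e = f ` ends G e))"

definition same_biased_graph :: "('v, 'e) bgraph \<Rightarrow> ('w, 'e) bgraph \<Rightarrow> bool" where
  "same_biased_graph \<Omega> \<Psi> \<longleftrightarrow>
     same_graph (ugraph \<Omega>) (ugraph \<Psi>) \<and> balanced_cycles \<Omega> = balanced_cycles \<Psi>"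


section \<open>Cycle matroids and frame matroids\<close>

text \<open>A matroid is given by its ground set and its circuits.\<close>

record 'e matroid =
  ground :: "'e set"
  circuits :: "'e set set"

definition cycle_matroid :: "('v, 'e) mgraph \<Rightarrow> 'e matroid" where
  "cycle_matroid G = \<lparr>ground = edges G, circuits = {C. cycle G C}\<rparr>"

definition frame_circuit :: "('v, 'e) bgraph \<Rightarrow> 'e set \<Rightarrow> bool" where
  "frame_circuit \<Omega> X \<longleftrightarrow>
     (let V = (\<lambda>Y. verts (restrict_edges (ugraph \<Omega>) Y)) in
       X \<in> balanced_cycles \<Omega> \<or>
       (\<exists>C D x. unbalanced_cycle \<Omega> C \<and> unbalanced_cycle \<Omega> D \<and> C \<inter> D = {} \<and>
          V C \<inter> V D = {x} \<and> X = C \<union> D) \<or>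
       (\<exists>C D P x y. unbalanced_cycle \<Omega> C \<and> unbalanced_cycle \<Omega> D \<and> V C \<inter> V D = {} \<and>
          path_between (ugraph \<Omega>) x y P \<and> V P \<inter> V C = {x} \<and> V P \<inter> V D = {y} \<and>
          X = C \<union> D \<union> P) \<or>
       (theta (ugraph \<Omega>) X \<and> (\<forall>C. cycle (ugraph \<Omega>) C \<and> C \<subseteq> X \<longrightarrow> unbalanced_cycle \<Omega> C)))"

definition frame_matroid :: "('v, 'e) bgraph \<Rightarrow> 'e matroid" where
  "frame_matroid \<Omega> = \<lparr>ground = edges (ugraph \<Omega>), circuits = {X. frame_circuit \<Omega> X}\<rparr>"


section \<open>Curlings and pinches\<close>

definition curling_data ::
    "('v, 'e) mgraph \<Rightarrow> 'v \<Rightarrow> nat \<Rightarrow> (nat \<Rightarrow> 'v) \<Rightarrow> (nat \<Rightarrow> ('v, 'e) mgraph) \<Rightarrow> bool" where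
  "curling_data H v k vs Hs \<longleftrightarrow> two_connected H \<and> v \<in> verts H \<and>
     inj_on vs {..<k} \<and> (\<forall>i<k. vs i \<in> verts H - {v}) \<and>
     (\<forall>i<k. subgraph (Hs i) H \<and> connected_graph (Hs i) \<and>
        verts (Hs i) \<inter> verts (restrict_edges H (edges H - edges (Hs i))) = {v, vs i}) \<and>
     (\<forall>i<k. \<forall>j<k. i \<noteq> j \<longrightarrow> edges (Hs i) \<inter> edges (Hs j) = {}) \<and>
     (\<forall>e\<in>edges H. v \<in> ends H e \<longrightarrow> (\<exists>i<k. e \<in> edges (Hs i)))"

text \<open>
  The end \<open>v\<close> of an edge of \<open>Hs i\<close> is replaced by \<open>vs i\<close>. Since the \<open>Hs i\<close> are edge-disjoint and
  cover all edges at \<open>v\<close>, the set of replacing vertices below is a singleton.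
\<close>

definition curled_graph ::
    "('v, 'e) mgraph \<Rightarrow> 'v \<Rightarrow> nat \<Rightarrow> (nat \<Rightarrow> 'v) \<Rightarrow> (nat \<Rightarrow> ('v, 'e) mgraph) \<Rightarrow> ('v, 'e) mgraph" where
  "curled_graph H v k vs Hs =
     \<lparr>verts = verts H - {v}, edges = edges H,
      ends = (\<lambda>e. if v \<in> ends H e
                  then (ends H e - {v}) \<union> {vs i | i. i < k \<and> e \<in> edges (Hs i)}
                  else ends H e)\<rparr>"

definition simple_curling_of :: "('w, 'e) bgraph \<Rightarrow> ('v, 'e) mgraph \<Rightarrow> bool" where
  "simple_curling_of \<Omega> H \<longleftrightarrow>
     (\<exists>v k vs Hs. curling_data H v k vs Hs \<and>
        (\<forall>i<k. \<forall>e\<in>edges (Hs i). ends H e = {v, vs i}) \<and>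
        same_biased_graph \<Omega>
          (signed_graph (curled_graph H v k vs Hs) {e \<in> edges H. v \<in> ends H e}))"

text \<open>The vertex obtained by identifying \<open>v\<^sub>1\<close> and \<open>v\<^sub>2\<close> reuses the name \<open>v\<^sub>1\<close>.\<close>

definition identify_verts :: "('v, 'e) mgraph \<Rightarrow> 'v \<Rightarrow> 'v \<Rightarrow> ('v, 'e) mgraph" where
  "identify_verts H v\<^sub>1 v\<^sub>2 =
     \<lparr>verts = verts H - {v\<^sub>2}, edges = edges H,
      ends = (\<lambda>e. (\<lambda>u. if u = v\<^sub>2 then v\<^sub>1 else u) ` ends H e)\<rparr>"

definition pinch_of :: "('w, 'e) bgraph \<Rightarrow> ('v, 'e) mgraph \<Rightarrow> bool" where
  "pinch_of \<Omega> H \<longleftrightarrow>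
     (\<exists>v\<^sub>1 v\<^sub>2. v\<^sub>1 \<in> verts H \<and> v\<^sub>2 \<in> verts H \<and> v\<^sub>1 \<noteq> v\<^sub>2 \<and>
        same_biased_graph \<Omega>
          (signed_graph (identify_verts H v\<^sub>1 v\<^sub>2) {e \<in> edges H. v\<^sub>1 \<in> ends H e}))"

end

theory Submission
  imports Defs
begin

text \<open>
  Deleting at most three vertices leaves \<open>G\<close> connected, so any two edges of \<open>G\<close> at a vertex \<open>b\<close> lie in
  a cycle that uses no other edge at \<open>b\<close> and avoids up to two prescribed vertices. As circuits of the
  frame matroid are connected and have no vertices of degree one, for every vertex \<open>u\<close> of \<open>G\<close> either
  the star of \<open>u\<close> is the star of a vertex of \<open>\<Omega>\<close>, or \<open>u\<close> is hidden: the edges of \<open>G - u\<close> then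
  form a balanced subgraph of \<open>\<Omega>\<close> that meets all vertices. Inside this balanced subgraph the same
  argument recovers the stars of all other vertices, which rules out three hidden vertices.
  Without hidden vertices \<open>\<Omega>\<close> is \<open>G\<close>, a single hidden vertex gives a curling, and two give a pinch.
\<close>

section \<open>Paths as paired lists, and cycles as closed paths\<close>

section \<open>Paths and cycles\<close>

text \<open>Circuits are the only link between the two graphs, so a vertex of \<open>G\<close> has
  to be recognised from them. The complement of its star is not spanning, and in a biased graph a
  connected edge set fails to span for one of two reasons: it misses a vertex, or it is balanced. In
  the first case an edge at the missed vertex must be an edge at the deleted one, which recovers the
  star; the second case produces the hidden vertices. Ranks never appear: that a set spans an edge
  is expressed by a circuit through this edge inside the set, and such a circuit is refuted as a
  cycle of \<open>G\<close> with a vertex of degree one.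

  The three vertices whose deletion keeps \<open>G\<close> connected are spent on a hidden vertex,
  on the vertex whose star is sought, and on the common vertex of two edges that are to be joined by
  a cycle.

  Although \<open>G\<close> has no loops, \<Omega> may have them: the edges that a curling or a
  pinch bends. Statements on degrees therefore treat loops separately.\<close>

definition vset :: "('v, 'e) mgraph \<Rightarrow> 'e set \<Rightarrow> 'v set" where
  "vset G Y = (\<Union>e\<in>Y. ends G e)"

lemma verts_restrict_edges [simp]: "verts (restrict_edges G Y) = vset G Y"
  by (simp add: restrict_edges_def vset_def)

lemma vset_Un: "vset G (A \<union> B) = vset G A \<union> vset G B"
  by (auto simp: vset_def)

lemma vset_insert: "vset G (insert e A) = ends G e \<union> vset G A"
  by (auto simp: vset_def)

lemma vset_mono: "A \<subseteq> B \<Longrightarrow> vset G A \<subseteq> vset G B"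
  by (auto simp: vset_def)

text \<open>Unlike \<open>path_between\<close>, this keeps the two lists and admits the trivial path
  without edges. Paths can then be built and cut by induction, and a loop becomes a closed trivial
  path.\<close>

inductive path :: "('v, 'e) mgraph \<Rightarrow> 'v list \<Rightarrow> 'e list \<Rightarrow> bool" for G where
  Nil: "path G [v] []"
| Cons: "path G (v # vs) (e # es)"
    if "e \<in> edges G" "ends G e = {v, hd vs}" "v \<notin> set vs" "path G vs es"

lemma path_nonempty: "path G vs es \<Longrightarrow> vs \<noteq> []"
  by (induction rule: path.induct) auto

lemma path_distinct: "path G vs es \<Longrightarrow> distinct vs"
  by (induction rule: path.induct) auto

lemma path_edges: "path G vs es \<Longrightarrow> set es \<subseteq> edges G"
  by (induction rule: path.induct) auto

lemma path_hd_last: "path G vs es \<Longrightarrow> hd vs = last vs \<longleftrightarrow> es = []"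
  by (induction rule: path.induct) (auto dest: path_nonempty)

lemma path_vset_subset: "path G vs es \<Longrightarrow> vset G (set es) \<subseteq> set vs"
  by (induction rule: path.induct) (auto simp: vset_def dest: path_nonempty)

lemma path_vset: "path G vs es \<Longrightarrow> es \<noteq> [] \<Longrightarrow> vset G (set es) = set vs"
proof (induction rule: path.induct)
  case (Cons e v vs es)
  show ?case
  proof (cases "es = []")
    case True
    then have "vs = [hd vs]"
      using Cons.hyps by (auto elim: path.cases)
    then show ?thesis
      using Cons.hyps True
      by (metis (no_types, lifting) empty_set list.simps(15) sup_bot_right vset_def vset_insert UN_empty)
  next
    case False
    then show ?thesis
      using Cons path_nonempty[OF Cons.hyps(4)] by (auto simp: vset_insert)
  qed
qed simp

lemma path_distinct_edges: "path G vs es \<Longrightarrow> distinct es"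
proof (induction rule: path.induct)
  case (Cons e v vs es)
  then show ?case using path_vset_subset[OF Cons.hyps(4)] by (auto simp: vset_def)
qed simp

lemma path_nonloop: "path G vs es \<Longrightarrow> e \<in> set es \<Longrightarrow> ends G e \<noteq> {w} \<and> ends G e \<noteq> {}"
proof (induction rule: path.induct)
  case (Cons e v vs es)
  then show ?case using path_nonempty[OF Cons.hyps(4)] by (auto simp: doubleton_eq_iff)
qed simp

lemma path_append:
  "path G vs es \<Longrightarrow> path G ws fs \<Longrightarrow> last vs = hd ws \<Longrightarrow> set vs \<inter> set (tl ws) = {}
    \<Longrightarrow> path G (vs @ tl ws) (es @ fs)"
proof (induction rule: path.induct)
  case (Nil v)
  then show ?case using path_nonempty[OF Nil(1)] by (cases ws) auto
next
  case (Cons e v vs es)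
  then show ?case using path_nonempty[OF Cons.hyps(4)]
    by (auto intro!: path.Cons)
qed

lemma path_single: "e \<in> edges G \<Longrightarrow> ends G e = {v, w} \<Longrightarrow> v \<noteq> w \<Longrightarrow> path G [v, w] [e]"
  using path.Cons[OF _ _ _ path.Nil, of e G v w] by simp

lemma path_rev: "path G vs es \<Longrightarrow> path G (rev vs) (rev es)"
proof (induction rule: path.induct)
  case (Cons e v vs es)
  have ne: "vs \<noteq> []" using Cons.hyps by (auto dest: path_nonempty)
  then have "path G [hd vs, v] [e]"
    using Cons.hyps by (intro path_single) auto
  from path_append[OF Cons.IH this] show ?case
    using ne Cons.hyps by (auto simp: last_rev)
qed (auto intro: path.Nil)

lemma path_split:
  "path G (A @ x # B) es \<Longrightarrow> \<exists>es1 es2. es = es1 @ es2 \<and> path G (A @ [x]) es1 \<and> path G (x # B) es2"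
proof (induction A arbitrary: es)
  case Nil
  then show ?case by (auto intro: path.Nil)
next
  case (Cons a A)
  from Cons.prems obtain e es' where es: "es = e # es'" "e \<in> edges G"
    "ends G e = {a, hd (A @ x # B)}" "a \<notin> set (A @ x # B)" "path G (A @ x # B) es'"
    by (auto elim: path.cases)
  from Cons.IH[OF this(5)] obtain es1 es2 where
    *: "es' = es1 @ es2" "path G (A @ [x]) es1" "path G (x # B) es2" by blast
  have "hd (A @ x # B) = hd (A @ [x])" by (cases A) auto
  then have "path G (a # A @ [x]) (e # es1)"
    using es * by (intro path.Cons) auto
  then show ?case using * es by (intro exI[of _ "e # es1"] exI[of _ es2]) auto
qed

lemma path_iff_nth:
  "path G vs es \<longleftrightarrow> length vs = Suc (length es) \<and> distinct vs \<and> set es \<subseteq> edges G \<and>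
     (\<forall>i<length es. ends G (es ! i) = {vs ! i, vs ! Suc i})" (is "_ \<longleftrightarrow> ?R vs es")
proof
  show "path G vs es \<Longrightarrow> ?R vs es"
  proof (induction rule: path.induct)
    case (Cons e v vs es)
    then show ?case
      by (auto simp: nth_Cons' hd_conv_nth dest: path_nonempty)
  qed simp
next
  show "?R vs es \<Longrightarrow> path G vs es"
  proof (induction es arbitrary: vs)
    case Nil
    then show ?case by (auto simp: length_Suc_conv intro: path.Nil)
  next
    case (Cons e es)
    then obtain v ws where vs: "vs = v # ws" "length ws = Suc (length es)"
      by (auto simp: length_Suc_conv)
    have "?R ws es"
      using Cons.prems vs by fastforce
    then have "path G ws es" by (rule Cons.IH)
    moreover have "ends G e = {v, hd ws}"
    proof -
      have "ends G ((e # es) ! 0) = {vs ! 0, vs ! Suc 0}" using Cons.prems by blast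
      then show ?thesis using vs by (cases ws) auto
    qed
    ultimately show ?case
      using Cons.prems vs by (auto intro!: path.Cons)
  qed
qed

lemma path_between_iff:
  "path_between G x y P \<longleftrightarrow>
     (\<exists>vs es. path G vs es \<and> es \<noteq> [] \<and> hd vs = x \<and> last vs = y \<and> P = set es)"
  unfolding path_between_def path_iff_nth by (intro ex_cong1) auto

lemma path_between_sym: "path_between G x y P \<Longrightarrow> path_between G y x P"
  unfolding path_between_iff
  by (metis hd_rev last_rev path_rev rev_is_Nil_conv set_rev)

text \<open>The cycle is cut open at its last edge. The condition \<open>e \<notin> set es\<close>
  matters for paths with one edge, which would otherwise be closed by that same edge.\<close>

lemma cycle_iff:
  "cycle G C \<longleftrightarrow> (\<exists>vs es e. path G vs es \<and> e \<in> edges G \<and> e \<notin> set es \<and>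
     ends G e = {hd vs, last vs} \<and> C = insert e (set es))"
proof
  assume "cycle G C"
  then obtain vs es where *: "es \<noteq> []" "length vs = length es" "distinct vs" "distinct es"
    "C = set es" "C \<subseteq> edges G"
    "\<forall>i<length es. ends G (es ! i) = {vs ! i, vs ! (Suc i mod length es)}"
    unfolding cycle_def by blast
  then obtain es' e where es: "es = es' @ [e]" by (metis rev_exhaust)
  have "ends G (es' ! i) = {vs ! i, vs ! Suc i}" if "i < length es'" for i
    using *(7)[rule_format, of i] that es by (auto simp: nth_append)
  then have "path G vs es'"
    unfolding path_iff_nth using * es by auto
  moreover have "ends G e = {hd vs, last vs}"
    using *(7)[rule_format, of "length es'"] * es
    by (auto simp: hd_conv_nth last_conv_nth simp flip: length_greater_0_conv)
  ultimately show "\<exists>vs es e. path G vs es \<and> e \<in> edges G \<and> e \<notin> set es \<and>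
     ends G e = {hd vs, last vs} \<and> C = insert e (set es)"
    using * es by (intro exI[of _ vs] exI[of _ es'] exI[of _ e]) auto
next
  assume "\<exists>vs es e. path G vs es \<and> e \<in> edges G \<and> e \<notin> set es \<and>
     ends G e = {hd vs, last vs} \<and> C = insert e (set es)"
  then obtain vs es e where *: "path G vs es" "e \<in> edges G" "e \<notin> set es"
    "ends G e = {hd vs, last vs}" "C = insert e (set es)" by blast
  have len: "length vs = Suc (length es)"
    and ends: "\<And>i. i < length es \<Longrightarrow> ends G (es ! i) = {vs ! i, vs ! Suc i}"
    using *(1) unfolding path_iff_nth by auto
  have "ends G ((es @ [e]) ! i) = {vs ! i, vs ! (Suc i mod length (es @ [e]))}"
    if "i < length (es @ [e])" for i
  proof (cases "i < length es")
    case True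
    then show ?thesis using ends by (auto simp: nth_append)
  next
    case False
    then have "i = length es" using that by simp
    then show ?thesis using * len path_nonempty[OF *(1)] by (auto simp: hd_conv_nth last_conv_nth)
  qed
  then show "cycle G C"
    unfolding cycle_def using * len path_distinct[OF *(1)] path_distinct_edges[OF *(1)] path_edges[OF *(1)]
    by (intro exI[of _ vs] exI[of _ "es @ [e]"]) auto
qed

lemma cycleI:
  "path G vs es \<Longrightarrow> e \<in> edges G \<Longrightarrow> e \<notin> set es \<Longrightarrow> ends G e = {hd vs, last vs}
    \<Longrightarrow> cycle G (insert e (set es))"
  unfolding cycle_iff by blast

lemma cycleE:
  assumes "cycle G C"
  obtains vs es e where "path G vs es" "e \<in> edges G" "e \<notin> set es"
    "ends G e = {hd vs, last vs}" "C = insert e (set es)"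
  using assms unfolding cycle_iff by blast

lemma cycle_edges: "cycle G C \<Longrightarrow> C \<subseteq> edges G"
  by (auto elim!: cycleE dest!: path_edges)

lemma cycle_nonempty: "cycle G C \<Longrightarrow> C \<noteq> {}"
  by (auto elim!: cycleE)

lemma vset_closed_path:
  assumes "path G vs es" "ends G e = {hd vs, last vs}"
  shows "vset G (insert e (set es)) = set vs"
proof (cases "es = []")
  case True
  then have "vs = [hd vs]" using assms by (auto elim: path.cases)
  then show ?thesis
    using True assms
    by (metis empty_set insert_absorb2 last.simps list.simps(15) sup_bot_right vset_def vset_insert UN_empty)
next
  case False
  then show ?thesis using path_vset[OF assms(1)] path_nonempty[OF assms(1)] assms(2)
    by (auto simp: vset_insert)
qed

section \<open>Degrees in paths and cycles, and minimality of cycles\<close>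

section \<open>Degrees\<close>

lemma path_other_edge:
  "path G vs es \<Longrightarrow> e \<in> set es \<Longrightarrow> w \<in> ends G e \<Longrightarrow> w \<noteq> hd vs \<Longrightarrow> w \<noteq> last vs
    \<Longrightarrow> \<exists>f\<in>set es - {e}. w \<in> ends G f"
proof (induction rule: path.induct)
  case (Cons d v vs es)
  have ne: "vs \<noteq> []" using Cons.hyps by (auto dest: path_nonempty)
  have d: "d \<notin> set es"
    using path_vset_subset[OF Cons.hyps(4)] Cons.hyps by (auto simp: vset_def)
  have wl: "w \<noteq> last vs" "w \<noteq> v" using Cons.prems ne by auto
  show ?case
  proof (cases "w = hd vs")
    case True
    then have es: "es \<noteq> []" using wl path_hd_last[OF Cons.hyps(4)] by auto
    show ?thesis
    proof (cases "e = d")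
      case True
      have "w \<in> vset G (set es)"
        using path_vset[OF Cons.hyps(4) es] \<open>w = hd vs\<close> ne by auto
      then show ?thesis using d True by (auto simp: vset_def)
    next
      case False
      then show ?thesis using \<open>w = hd vs\<close> Cons.hyps by (intro bexI[of _ d]) auto
    qed
  next
    case False
    then have "e \<in> set es" using Cons.prems wl Cons.hyps by auto
    then show ?thesis using Cons.IH Cons.prems(2) False wl by auto
  qed
qed simp

lemma path_degree:
  "path G vs es \<Longrightarrow> card {e \<in> set es. w \<in> ends G e} \<le> (if w = hd vs \<or> w = last vs then 1 else 2)"
proof (induction rule: path.induct)
  case (Cons d v vs es)
  have ne: "vs \<noteq> []" using Cons.hyps by (auto dest: path_nonempty)
  have sub: "vset G (set es) \<subseteq> set vs" by (rule path_vset_subset[OF Cons.hyps(4)])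
  consider "w = v" | "w \<noteq> v" "w = hd vs" | "w \<noteq> v" "w \<noteq> hd vs" by blast
  then show ?case
  proof cases
    case 1
    then have "{e \<in> set (d # es). w \<in> ends G e} \<subseteq> {d}"
      using Cons.hyps sub by (auto simp: vset_def)
    from card_mono[OF _ this] show ?thesis using 1 by simp
  next
    case 2
    have eq: "{e \<in> set (d # es). w \<in> ends G e} = insert d {e \<in> set es. w \<in> ends G e}"
      using 2 Cons.hyps by auto
    show ?thesis
    proof (cases "es = []")
      case True
      then show ?thesis using eq by auto
    next
      case False
      then have "w \<noteq> last vs" using 2 path_hd_last[OF Cons.hyps(4)] by auto
      then show ?thesis using eq 2 Cons.IH ne by (auto simp: card_insert_if)
    qed
  next
    case 3
    then have "{e \<in> set (d # es). w \<in> ends G e} = {e \<in> set es. w \<in> ends G e}"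
      using Cons.hyps by auto
    then show ?thesis using 3 Cons.IH ne by auto
  qed
qed simp

text \<open>An inner vertex lies on just two edges of the path, so the hypothesis passes membership
  in \<open>S\<close> from each edge to the next. It serves for the minimality of cycles and for
  cycles inside a theta graph, which contain a branch entirely or not at all.\<close>

lemma path_all_or_nothing:
  "path G vs es \<Longrightarrow>
    (\<And>g w. g \<in> S \<Longrightarrow> g \<in> set es \<Longrightarrow> w \<in> ends G g \<Longrightarrow> w \<noteq> hd vs \<Longrightarrow> w \<noteq> last vs \<Longrightarrow>
       \<exists>f\<in>S \<inter> set es - {g}. w \<in> ends G f) \<Longrightarrow> set es \<subseteq> S \<or> set es \<inter> S = {}"
proof (induction rule: path.induct)
  case (Cons d v vs es)
  have ne: "vs \<noteq> []" using Cons.hyps by (auto dest: path_nonempty)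
  have sub: "vset G (set es) \<subseteq> set vs" by (rule path_vset_subset[OF Cons.hyps(4)])
  have IH: "set es \<subseteq> S \<or> set es \<inter> S = {}"
  proof (rule Cons.IH)
    fix g w assume g: "g \<in> S" "g \<in> set es" "w \<in> ends G g" "w \<noteq> hd vs" "w \<noteq> last vs"
    have wv: "w \<noteq> v" using g sub Cons.hyps by (auto simp: vset_def)
    then obtain f where "f \<in> S \<inter> set (d # es) - {g}" "w \<in> ends G f"
      using Cons.prems[of g w] g ne by auto
    then show "\<exists>f\<in>S \<inter> set es - {g}. w \<in> ends G f"
      using wv g Cons.hyps by auto
  qed
  show ?case
  proof (cases "es = []")
    case True
    then show ?thesis by auto
  next
    case False
    have w: "hd vs \<noteq> v" "hd vs \<noteq> last vs"
      using Cons.hyps ne False path_hd_last[OF Cons.hyps(4)] by auto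
    have "hd vs \<in> vset G (set es)"
      using path_vset[OF Cons.hyps(4) False] ne by auto
    then obtain g where g: "g \<in> set es" "hd vs \<in> ends G g" by (auto simp: vset_def)
    \<comment> \<open>Only \<open>g\<close> and the new edge \<open>d\<close> contain
      \<open>hd vs\<close>, so \<open>d\<close> is the second edge that closure of \<open>S\<close>
      requires there.\<close>
    have "card {e \<in> set es. hd vs \<in> ends G e} \<le> 1"
      using path_degree[OF Cons.hyps(4), of "hd vs"] by simp
    then have uniq: "f = g" if "f \<in> set es" "hd vs \<in> ends G f" for f
      using that g by (auto simp: card_le_Suc0_iff_eq)
    from IH show ?thesis
    proof
      assume "set es \<subseteq> S"
      then obtain f where "f \<in> S \<inter> set (d # es) - {g}" "hd vs \<in> ends G f"
        using Cons.prems[of g "hd vs"] g w ne by auto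
      then have "d \<in> S" using uniq by auto
      then show ?thesis using \<open>set es \<subseteq> S\<close> by auto
    next
      assume 0: "set es \<inter> S = {}"
      have "d \<notin> S"
      proof
        assume "d \<in> S"
        then obtain f where "f \<in> S \<inter> set (d # es) - {d}"
          using Cons.prems[of d "hd vs"] Cons.hyps w ne by auto
        then show False using 0 by auto
      qed
      then show ?thesis using 0 by auto
    qed
  qed
qed simp

text \<open>The first alternative is a loop, which meets its vertex twice although it is one
  edge.\<close>

lemma cycle_other_edge:
  assumes "cycle G C" "e \<in> C" "w \<in> ends G e"
  shows "C = {e} \<and> ends G e = {w} \<or> (\<exists>f\<in>C - {e}. w \<in> ends G f)"
proof -
  obtain vs es d where *: "path G vs es" "d \<in> edges G" "d \<notin> set es"
    "ends G d = {hd vs, last vs}" "C = insert d (set es)"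
    using assms(1) by (rule cycleE)
  show ?thesis
  proof (cases "e = d")
    case True
    show ?thesis
    proof (cases "es = []")
      case True
      then show ?thesis using \<open>e = d\<close> * path_hd_last[OF *(1)] assms(3) by auto
    next
      case False
      then have "w \<in> vset G (set es)"
        using path_vset[OF *(1) False] path_nonempty[OF *(1)] \<open>e = d\<close> * assms by auto
      then show ?thesis using \<open>e = d\<close> * by (auto simp: vset_def)
    qed
  next
    case False
    then have "e \<in> set es" using * assms by auto
    show ?thesis
    proof (cases "w = hd vs \<or> w = last vs")
      case True
      then show ?thesis using * False by (intro disjI2 bexI[of _ d]) auto
    next
      case False
      then show ?thesis using path_other_edge[OF *(1) \<open>e \<in> set es\<close> assms(3)] * by auto
    qed
  qed
qed

lemma cycle_degree_le:
  assumes "cycle G C"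
  shows "card {e \<in> C. w \<in> ends G e} \<le> 2"
proof -
  obtain vs es d where *: "path G vs es" "d \<in> edges G" "d \<notin> set es"
    "ends G d = {hd vs, last vs}" "C = insert d (set es)"
    using assms by (rule cycleE)
  have "{e \<in> C. w \<in> ends G e} =
      (if w = hd vs \<or> w = last vs then insert d {e \<in> set es. w \<in> ends G e} else {e \<in> set es. w \<in> ends G e})"
    using * by auto
  then show ?thesis
    using path_degree[OF *(1), of w] by (auto simp: card_insert_if split: if_splits)
qed

text \<open>The smaller cycle has no vertex of degree one, so it contains all or nothing of the path
  left by removing \<open>d\<close>. In the first case an end of the path forces \<open>d\<close>
  in; in the second the smaller cycle is the loop \<open>d\<close>, and the path is trivial.\<close>

lemma cycle_subset_cycle:
  assumes "cycle G C" "cycle G C'" "C' \<subseteq> C"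
  shows "C' = C"
proof -
  obtain vs es d where *: "path G vs es" "d \<in> edges G" "d \<notin> set es"
    "ends G d = {hd vs, last vs}" "C = insert d (set es)"
    using assms(1) by (rule cycleE)
  have other: "\<exists>f\<in>C' - {g}. w \<in> ends G f" if "g \<in> C'" "g \<in> set es" "w \<in> ends G g" for g w
    using cycle_other_edge[OF assms(2) that(1,3)] path_nonloop[OF *(1) that(2)] by auto
  have "set es \<subseteq> C' \<or> set es \<inter> C' = {}"
  proof (rule path_all_or_nothing[OF *(1)])
    fix g w assume g: "g \<in> C'" "g \<in> set es" "w \<in> ends G g" "w \<noteq> hd vs" "w \<noteq> last vs"
    then show "\<exists>f\<in>C' \<inter> set es - {g}. w \<in> ends G f"
      using other[OF g(1-3)] assms(3) * by auto
  qed
  then show ?thesis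
  proof
    assume sub: "set es \<subseteq> C'"
    have "d \<in> C'"
    proof (cases "es = []")
      case True
      then show ?thesis using assms(3) cycle_nonempty[OF assms(2)] * by auto
    next
      case False
      have "hd vs \<in> vset G (set es)"
        using path_vset[OF *(1) False] path_nonempty[OF *(1)] by auto
      then obtain g where g: "g \<in> set es" "hd vs \<in> ends G g" by (auto simp: vset_def)
      have "card {e \<in> set es. hd vs \<in> ends G e} \<le> 1"
        using path_degree[OF *(1), of "hd vs"] by simp
      then have uniq: "f = g" if "f \<in> set es" "hd vs \<in> ends G f" for f
        using that g by (auto simp: card_le_Suc0_iff_eq)
      obtain f where "f \<in> C'" "f \<noteq> g" "hd vs \<in> ends G f"
        using other[of g "hd vs"] g sub by blast
      then show ?thesis using uniq[of f] assms(3) *(5) by blast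
    qed
    then show ?thesis using sub * assms(3) by auto
  next
    assume "set es \<inter> C' = {}"
    then have C': "C' = {d}" using assms(3) * cycle_nonempty[OF assms(2)] by auto
    then have "hd vs = last vs"
      using cycle_other_edge[OF assms(2), of d "hd vs"] * by auto
    then show ?thesis using C' * path_hd_last[OF *(1)] by auto
  qed
qed

lemma loop_cycle: "e \<in> edges G \<Longrightarrow> ends G e = {v} \<Longrightarrow> cycle G {e}"
  using cycleI[OF path.Nil[of G v], of e] by simp

lemma cycle_with_loop: "cycle G C \<Longrightarrow> e \<in> C \<Longrightarrow> ends G e = {v} \<Longrightarrow> C = {e}"
  using cycle_subset_cycle[of G C "{e}"] loop_cycle[of e G v] cycle_edges[of G C] by blast

section \<open>Connected edge sets and paths inside them\<close>

section \<open>Connectivity\<close>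

definition adj :: "('v, 'e) mgraph \<Rightarrow> 'e set \<Rightarrow> ('v \<times> 'v) set" where
  "adj G Y = {(x, y). \<exists>e\<in>Y. ends G e = {x, y}}"

text \<open>Only vertices covered by \<open>Y\<close> count, so that the notion applies to bare edge
  sets such as circuits.\<close>

definition linked :: "('v, 'e) mgraph \<Rightarrow> 'e set \<Rightarrow> bool" where
  "linked G Y \<longleftrightarrow> (\<forall>p\<in>vset G Y. \<forall>q\<in>vset G Y. (p, q) \<in> (adj G Y)\<^sup>*)"

lemma adj_rtrancl_mono: "(p, q) \<in> (adj G A)\<^sup>* \<Longrightarrow> A \<subseteq> B \<Longrightarrow> (p, q) \<in> (adj G B)\<^sup>*"
  by (rule subsetD[OF rtrancl_mono]) (auto simp: adj_def)

lemma adj_rtrancl_sym: "(p, q) \<in> (adj G A)\<^sup>* \<Longrightarrow> (q, p) \<in> (adj G A)\<^sup>*"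
  by (rule symD[OF sym_rtrancl]) (auto simp: sym_def adj_def insert_commute)

lemma linkedI_root:
  assumes "\<And>p. p \<in> vset G Y \<Longrightarrow> (r, p) \<in> (adj G Y)\<^sup>*"
  shows "linked G Y"
  unfolding linked_def using assms by (meson adj_rtrancl_sym rtrancl_trans)

lemma path_reach: "path G vs es \<Longrightarrow> p \<in> set vs \<Longrightarrow> (hd vs, p) \<in> (adj G (set es))\<^sup>*"
proof (induction rule: path.induct)
  case (Cons e v vs es)
  show ?case
  proof (cases "p = v")
    case False
    then have "(hd vs, p) \<in> (adj G (set (e # es)))\<^sup>*"
      using Cons by (auto intro: adj_rtrancl_mono)
    moreover have "(v, hd vs) \<in> adj G (set (e # es))"
      using Cons.hyps by (auto simp: adj_def)
    ultimately show ?thesis by auto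
  qed auto
qed simp

lemma path_between_linked:
  assumes "path_between G x y P"
  shows "linked G P"
proof -
  obtain vs es where *: "path G vs es" "es \<noteq> []" "P = set es"
    using assms unfolding path_between_iff by blast
  show ?thesis
    using path_reach[OF *(1)] path_vset[OF *(1,2)] *(3) by (intro linkedI_root) auto
qed

lemma cycle_linked:
  assumes "cycle G C"
  shows "linked G C"
proof -
  obtain vs es e where *: "path G vs es" "ends G e = {hd vs, last vs}" "C = insert e (set es)"
    using assms by (auto elim: cycleE)
  show ?thesis
  proof (rule linkedI_root)
    fix p assume "p \<in> vset G C"
    then have "p \<in> set vs" using vset_closed_path[OF *(1,2)] *(3) by simp
    then show "(hd vs, p) \<in> (adj G C)\<^sup>*"
      using path_reach[OF *(1)] *(3) by (auto intro: adj_rtrancl_mono)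
  qed
qed

lemma linked_Un:
  assumes "linked G A" "linked G B" "r \<in> vset G A" "r \<in> vset G B"
  shows "linked G (A \<union> B)"
proof (rule linkedI_root)
  fix p assume "p \<in> vset G (A \<union> B)"
  then have "(r, p) \<in> (adj G A)\<^sup>* \<or> (r, p) \<in> (adj G B)\<^sup>*"
    using assms unfolding vset_Un linked_def by blast
  then show "(r, p) \<in> (adj G (A \<union> B))\<^sup>*"
    by (auto intro: adj_rtrancl_mono)
qed

text \<open>The walk is extended backwards from \<open>b\<close>. If the new vertex is already on
  the path, the path is cut back to its tail starting there.\<close>

lemma reach_path:
  assumes "(a, b) \<in> (adj G Y)\<^sup>*" "Y \<subseteq> edges G"
  shows "\<exists>vs es. path G vs es \<and> hd vs = a \<and> last vs = b \<and> set es \<subseteq> Y"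
  using assms(1)
proof (induction rule: converse_rtrancl_induct)
  case base
  show ?case by (intro exI[of _ "[b]"] exI[of _ "[]"]) (auto intro: path.Nil)
next
  case (step a c)
  then obtain vs es where *: "path G vs es" "hd vs = c" "last vs = b" "set es \<subseteq> Y" by blast
  from step obtain e where e: "e \<in> Y" "ends G e = {a, c}" by (auto simp: adj_def)
  show ?case
  proof (cases "a \<in> set vs")
    case True
    then obtain A B where vs: "vs = A @ a # B" by (meson split_list)
    then obtain es1 es2 where "es = es1 @ es2" "path G (a # B) es2"
      using path_split[of G A a B es] * by auto
    then show ?thesis using * vs by (intro exI[of _ "a # B"] exI[of _ es2]) auto
  next
    case False
    then have "path G (a # vs) (e # es)"
      using * e assms(2) by (intro path.Cons) auto
    then show ?thesis
      using * e path_nonempty[OF *(1)] by (intro exI[of _ "a # vs"] exI[of _ "e # es"]) auto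
  qed
qed

text \<open>On a path from \<open>a\<close> to \<open>b\<close>, the first vertex in
  \<open>T\<close> and the last vertex in \<open>S\<close> before it bound the desired
  piece.\<close>

lemma path_between_sets:
  assumes "linked G Y" "Y \<subseteq> edges G" "S \<inter> T = {}" "a \<in> S" "a \<in> vset G Y" "b \<in> T" "b \<in> vset G Y"
  shows "\<exists>x y P. path_between G x y P \<and> P \<subseteq> Y \<and> vset G P \<inter> S = {x} \<and> vset G P \<inter> T = {y}"
proof -
  obtain vs es where *: "path G vs es" "hd vs = a" "last vs = b" "set es \<subseteq> Y"
    using reach_path[of a b G Y] assms unfolding linked_def by blast
  have "\<exists>y\<in>set vs. y \<in> T" using * assms path_nonempty[OF *(1)] by (metis last_in_set)
  from split_list_first_prop[OF this] obtain A y B where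
    y: "vs = A @ y # B" "y \<in> T" "\<forall>z\<in>set A. z \<notin> T" by blast
  have "A \<noteq> []" using y * assms by (cases A) auto
  then have "a \<in> set A" using y * by (cases A) auto
  then have "\<exists>x\<in>set A. x \<in> S" using assms by auto
  from split_list_last_prop[OF this] obtain A1 x A2 where
    x: "A = A1 @ x # A2" "x \<in> S" "\<forall>z\<in>set A2. z \<notin> S" by blast
  obtain es1 es2 where 1: "es = es1 @ es2" "path G (A @ [y]) es1"
    using path_split[of G A y B es] * y by auto
  then obtain es3 es4 where 2: "es1 = es3 @ es4" "path G (x # A2 @ [y]) es4"
    using path_split[of G A1 x "A2 @ [y]" es1] x by auto
  have ne: "es4 \<noteq> []" using 2(2) by (auto elim: path.cases)
  have "path_between G x y (set es4)"
    unfolding path_between_iff using 2 ne by (intro exI[of _ "x # A2 @ [y]"] exI[of _ es4]) auto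
  moreover have V: "vset G (set es4) = insert x (insert y (set A2))"
    using path_vset[OF 2(2) ne] by auto
  moreover have "set es4 \<subseteq> Y" using 1(1) 2(1) *(4) by auto
  moreover have "vset G (set es4) \<inter> S = {x}" using V x(2,3) y(2) assms(3) by auto
  moreover have "vset G (set es4) \<inter> T = {y}" using V x(1,2) y(2,3) assms(3) by auto
  ultimately show ?thesis by blast
qed

section \<open>Theta graphs\<close>

text \<open>The arc \<open>Q\<close> is the one through the closing edge \<open>e\<close>: from
  \<open>y\<close> along \<open>D\<close>, over \<open>e\<close>, and along \<open>A\<close> to
  \<open>x\<close>. The last conjunct locates its other edges, which later keeps \<open>Q\<close>
  edge-disjoint from a second cycle that meets it only in \<open>x\<close> and
  \<open>y\<close>.\<close>

lemma cycle_split: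
  assumes "path G (A @ x # B @ y # D) es" "e \<in> edges G" "e \<notin> set es"
    "ends G e = {hd (A @ x # B @ y # D), last (A @ x # B @ y # D)}"
  shows "\<exists>P Q. path_between G x y P \<and> path_between G x y Q \<and> P \<inter> Q = {} \<and>
    P \<union> Q = insert e (set es) \<and> e \<in> Q \<and> vset G P = insert x (insert y (set B)) \<and>
    vset G Q = insert x (insert y (set A \<union> set D)) \<and>
    (\<forall>f\<in>Q - {e}. ends G f \<subseteq> insert x (set A) \<or> ends G f \<subseteq> insert y (set D))"
proof -
  have dist: "distinct (A @ x # B @ y # D)" using assms(1) by (rule path_distinct)
  obtain es1 es' where 1: "es = es1 @ es'" "path G (A @ [x]) es1" "path G (x # B @ y # D) es'"
    using path_split[OF assms(1)] by blast
  obtain es2 es3 where 2: "es' = es2 @ es3" "path G (x # B @ [y]) es2" "path G (y # D) es3"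
    using path_split[of G "x # B" y D es'] 1 by auto
  have ne: "es2 \<noteq> []" using 2(2) by (auto elim: path.cases)
  have hd: "hd (A @ x # B @ y # D) = hd (A @ [x])" by (cases A) auto
  have "path G (last (y # D) # A @ [x]) (e # es1)"
    using assms dist hd 1 by (intro path.Cons) (auto simp: insert_commute)
  from path_append[OF 2(3) this] have Q: "path G (y # D @ A @ [x]) (es3 @ e # es1)"
    using dist by auto
  have "path_between G y x (set (es3 @ e # es1))"
    unfolding path_between_iff
    using Q by (intro exI[of _ "y # D @ A @ [x]"] exI[of _ "es3 @ e # es1"]) auto
  then have Q': "path_between G x y (set (es3 @ e # es1))" by (rule path_between_sym)
  have P': "path_between G x y (set es2)"
    unfolding path_between_iff using 2 ne by (intro exI[of _ "x # B @ [y]"] exI[of _ es2]) auto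
  have "distinct es" using assms(1) by (rule path_distinct_edges)
  then have "set es2 \<inter> set (es3 @ e # es1) = {}" using 1 2 assms by auto
  moreover have "ends G f \<subseteq> insert x (set A) \<or> ends G f \<subseteq> insert y (set D)"
    if "f \<in> set (es3 @ e # es1) - {e}" for f
    using that path_vset_subset[OF 1(2)] path_vset_subset[OF 2(3)] by (auto simp: vset_def)
  moreover have "vset G (set es2) = insert x (insert y (set B))"
    using path_vset[OF 2(2) ne] by auto
  moreover have "vset G (set (es3 @ e # es1)) = insert x (insert y (set A \<union> set D))"
    using path_vset[OF Q] by auto
  ultimately show ?thesis
    using P' Q' 1 2 by (intro exI[of _ "set es2"] exI[of _ "set (es3 @ e # es1)"]) auto
qed

lemma cycle_two_paths:
  assumes "cycle G C" "x \<in> vset G C" "y \<in> vset G C" "x \<noteq> y"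
  shows "\<exists>P Q. path_between G x y P \<and> path_between G x y Q \<and> P \<inter> Q = {} \<and>
    P \<union> Q = C \<and> vset G P \<inter> vset G Q = {x, y}"
proof -
  obtain vs es e where *: "path G vs es" "e \<in> edges G" "e \<notin> set es"
    "ends G e = {hd vs, last vs}" "C = insert e (set es)"
    using assms(1) by (rule cycleE)
  have vs: "set vs = vset G C" using vset_closed_path[OF *(1,4)] *(5) by simp
  have main: "\<exists>P Q. path_between G x y P \<and> path_between G x y Q \<and> P \<inter> Q = {} \<and>
    P \<union> Q = C \<and> vset G P \<inter> vset G Q = {x, y}" if vs': "vs = A @ x # B @ y # D" for A B D x y
  proof -
    obtain P Q where "path_between G x y P" "path_between G x y Q" "P \<inter> Q = {}"
      "P \<union> Q = C" "vset G P = insert x (insert y (set B))"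
      "vset G Q = insert x (insert y (set A \<union> set D))"
      using cycle_split[OF *(1)[unfolded vs'] *(2,3) *(4)[unfolded vs']] *(5) by auto
    moreover have "insert x (insert y (set B)) \<inter> insert x (insert y (set A \<union> set D)) = {x, y}"
      using path_distinct[OF *(1)[unfolded vs']] by auto
    ultimately show ?thesis by metis
  qed
  obtain A B where AB: "vs = A @ x # B" using assms vs by (metis split_list)
  have "y \<in> set vs" using assms(3) vs by simp
  then consider "y \<in> set A" | "y \<in> set B" using AB assms(4) by auto
  then show ?thesis
  proof cases
    case 1
    then obtain A1 A2 where "A = A1 @ y # A2" by (meson split_list)
    then obtain P Q where "path_between G y x P \<and> path_between G y x Q \<and> P \<inter> Q = {} \<and>
      P \<union> Q = C \<and> vset G P \<inter> vset G Q = {y, x}" using main[of A1 y A2 x B] AB by auto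
    then show ?thesis
      using path_between_sym[of G y x P] path_between_sym[of G y x Q]
      by (intro exI[of _ P] exI[of _ Q]) auto
  next
    case 2
    then obtain B1 B2 where "B = B1 @ y # B2" by (meson split_list)
    then show ?thesis using main[of A x B1 y B2] AB by simp
  qed
qed

text \<open>The closing edge is the first edge of the second path; the rest of that path followed by
  the reversed first path is what it closes.\<close>

lemma two_paths_cycle:
  assumes "path_between G x y P" "path_between G x y Q" "P \<inter> Q = {}"
    "vset G P \<inter> vset G Q = {x, y}"
  shows "cycle G (P \<union> Q)"
proof -
  obtain vs es where P: "path G vs es" "es \<noteq> []" "hd vs = x" "last vs = y" "P = set es"
    using assms(1) unfolding path_between_iff by blast
  obtain us fs where Q: "path G us fs" "fs \<noteq> []" "hd us = x" "last us = y" "Q = set fs"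
    using assms(2) unfolding path_between_iff by blast
  obtain f fs' ws where f: "us = x # ws" "fs = f # fs'" "f \<in> edges G" "ends G f = {x, hd ws}"
    "x \<notin> set ws" "path G ws fs'"
    using Q by (auto elim: path.cases)
  have ws: "ws \<noteq> []" "last ws = y" using f Q path_nonempty[OF f(6)] by auto
  have rev: "path G (rev vs) (rev es)" using P by (intro path_rev)
  have vne: "vs \<noteq> []" by (rule path_nonempty[OF P(1)])
  have cap: "set vs \<inter> set us = {x, y}"
    using assms(4) path_vset[OF P(1,2)] path_vset[OF Q(1,2)] P Q by auto
  obtain rs where rs: "rev vs = y # rs"
    using P vne by (metis hd_rev list.collapse rev_is_Nil_conv)
  have "set vs = insert y (set rs)" by (metis rs set_rev list.simps(15))
  moreover have "y \<notin> set rs" using path_distinct[OF rev] rs by simp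
  ultimately have "set ws \<inter> set rs = {}"
    using cap f by auto
  then have path: "path G (ws @ rs) (fs' @ rev es)"
    using path_append[OF f(6) rev] ws rs by simp
  have "x \<noteq> y" using path_hd_last[OF P(1)] P by simp
  moreover have "last (y # rs) = x" using P rs vne by (metis last_rev)
  ultimately have last: "last (ws @ rs) = x" by (auto split: if_splits)
  have "cycle G (insert f (set (fs' @ rev es)))"
  proof (rule cycleI[OF path f(3)])
    show "f \<notin> set (fs' @ rev es)"
      using path_distinct_edges[OF Q(1)] f assms(3) P Q by auto
    show "ends G f = {hd (ws @ rs), last (ws @ rs)}"
      using f ws last by (simp add: insert_commute)
  qed
  moreover have "insert f (set (fs' @ rev es)) = P \<union> Q" using P Q f by auto
  ultimately show ?thesis by simp
qed

lemma path_between_nonempty: "path_between G x y P \<Longrightarrow> P \<noteq> {}"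
  unfolding path_between_iff by auto

lemma path_between_vset: "path_between G x y P \<Longrightarrow> x \<in> vset G P \<and> y \<in> vset G P"
  unfolding path_between_iff using path_vset path_nonempty by (metis hd_in_set last_in_set)

lemma path_between_nonloop: "path_between G x y P \<Longrightarrow> e \<in> P \<Longrightarrow> \<not> ends G e \<subseteq> {w}"
  unfolding path_between_iff using path_nonloop by (metis subset_singletonD)

lemma path_between_other_edge:
  "path_between G x y P \<Longrightarrow> e \<in> P \<Longrightarrow> w \<in> ends G e \<Longrightarrow> w \<noteq> x \<Longrightarrow> w \<noteq> y
    \<Longrightarrow> \<exists>f\<in>P - {e}. w \<in> ends G f"
  unfolding path_between_iff using path_other_edge by metis

lemma thetaI:
  assumes "x \<noteq> y" "path_between G x y P" "path_between G x y Q" "path_between G x y R"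
    "P \<inter> Q = {}" "P \<inter> R = {}" "Q \<inter> R = {}" "vset G P \<inter> vset G Q = {x, y}"
    "vset G P \<inter> vset G R = {x, y}" "vset G Q \<inter> vset G R = {x, y}"
  shows "theta G (P \<union> Q \<union> R)"
  unfolding theta_def verts_restrict_edges using assms
  by (intro exI conjI) (assumption | rule refl)+

lemma theta_cycle:
  assumes "theta G T"
  shows "\<exists>C. cycle G C \<and> C \<subset> T"
proof -
  obtain x y P Q R where *: "path_between G x y P" "path_between G x y Q" "path_between G x y R"
    "P \<inter> Q = {}" "P \<inter> R = {}" "Q \<inter> R = {}" "vset G P \<inter> vset G Q = {x, y}" "T = P \<union> Q \<union> R"
    using assms unfolding theta_def verts_restrict_edges by blast
  have "R \<noteq> {}" using * by (auto dest: path_between_nonempty)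
  then have "P \<union> Q \<subset> T" using * by auto
  then show ?thesis using two_paths_cycle[of G x y P Q] * by blast
qed

section \<open>Degrees, connectedness and spanning in the frame matroid\<close>

section \<open>Frame circuits\<close>

lemma frame_circuit_iff:
  "frame_circuit \<Omega> X \<longleftrightarrow> X \<in> balanced_cycles \<Omega> \<or>
     (\<exists>C D x. unbalanced_cycle \<Omega> C \<and> unbalanced_cycle \<Omega> D \<and> C \<inter> D = {} \<and>
        vset (ugraph \<Omega>) C \<inter> vset (ugraph \<Omega>) D = {x} \<and> X = C \<union> D) \<or>
     (\<exists>C D P x y. unbalanced_cycle \<Omega> C \<and> unbalanced_cycle \<Omega> D \<and>
        vset (ugraph \<Omega>) C \<inter> vset (ugraph \<Omega>) D = {} \<and>
        path_between (ugraph \<Omega>) x y P \<and> vset (ugraph \<Omega>) P \<inter> vset (ugraph \<Omega>) C = {x} \<and>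
        vset (ugraph \<Omega>) P \<inter> vset (ugraph \<Omega>) D = {y} \<and> X = C \<union> D \<union> P) \<or>
     (theta (ugraph \<Omega>) X \<and> (\<forall>C. cycle (ugraph \<Omega>) C \<and> C \<subseteq> X \<longrightarrow> unbalanced_cycle \<Omega> C))"
  unfolding frame_circuit_def Let_def verts_restrict_edges ..

lemma frame_circuit_balancedI: "C \<in> balanced_cycles \<Omega> \<Longrightarrow> frame_circuit \<Omega> C"
  unfolding frame_circuit_iff by (rule disjI1)

lemma frame_circuit_tightI:
  assumes "unbalanced_cycle \<Omega> C" "unbalanced_cycle \<Omega> D" "C \<inter> D = {}"
    "vset (ugraph \<Omega>) C \<inter> vset (ugraph \<Omega>) D = {x}"
  shows "frame_circuit \<Omega> (C \<union> D)"
  unfolding frame_circuit_iff using assms by (intro disjI2[OF disjI1] exI conjI) (assumption | rule refl)+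

lemma frame_circuit_looseI:
  assumes "unbalanced_cycle \<Omega> C" "unbalanced_cycle \<Omega> D"
    "vset (ugraph \<Omega>) C \<inter> vset (ugraph \<Omega>) D = {}" "path_between (ugraph \<Omega>) x y P"
    "vset (ugraph \<Omega>) P \<inter> vset (ugraph \<Omega>) C = {x}" "vset (ugraph \<Omega>) P \<inter> vset (ugraph \<Omega>) D = {y}"
  shows "frame_circuit \<Omega> (C \<union> D \<union> P)"
  unfolding frame_circuit_iff using assms
  by (intro disjI2[OF disjI2[OF disjI1]] exI conjI) (assumption | rule refl)+

lemma frame_circuit_thetaI:
  assumes "theta (ugraph \<Omega>) X" "\<forall>C. cycle (ugraph \<Omega>) C \<and> C \<subseteq> X \<longrightarrow> unbalanced_cycle \<Omega> C"
  shows "frame_circuit \<Omega> X"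
  unfolding frame_circuit_iff using assms by simp

lemma frame_circuit_cases [consumes 2, case_names balanced tight loose theta]:
  assumes "frame_circuit \<Omega> X" "biased_graph \<Omega>"
  obtains "X \<in> balanced_cycles \<Omega>" "cycle (ugraph \<Omega>) X"
  | C D x where "unbalanced_cycle \<Omega> C" "unbalanced_cycle \<Omega> D" "C \<inter> D = {}"
      "vset (ugraph \<Omega>) C \<inter> vset (ugraph \<Omega>) D = {x}" "X = C \<union> D"
      "cycle (ugraph \<Omega>) C" "cycle (ugraph \<Omega>) D"
  | C D P x y where "unbalanced_cycle \<Omega> C" "unbalanced_cycle \<Omega> D"
      "vset (ugraph \<Omega>) C \<inter> vset (ugraph \<Omega>) D = {}" "path_between (ugraph \<Omega>) x y P"
      "vset (ugraph \<Omega>) P \<inter> vset (ugraph \<Omega>) C = {x}" "vset (ugraph \<Omega>) P \<inter> vset (ugraph \<Omega>) D = {y}"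
      "X = C \<union> D \<union> P" "cycle (ugraph \<Omega>) C" "cycle (ugraph \<Omega>) D"
  | x y P Q R where "x \<noteq> y" "path_between (ugraph \<Omega>) x y P" "path_between (ugraph \<Omega>) x y Q"
      "path_between (ugraph \<Omega>) x y R" "P \<inter> Q = {}" "P \<inter> R = {}" "Q \<inter> R = {}" "X = P \<union> Q \<union> R"
      "theta (ugraph \<Omega>) X" "\<forall>C. cycle (ugraph \<Omega>) C \<and> C \<subseteq> X \<longrightarrow> unbalanced_cycle \<Omega> C"
proof -
  consider "X \<in> balanced_cycles \<Omega>"
    | "\<exists>C D x. unbalanced_cycle \<Omega> C \<and> unbalanced_cycle \<Omega> D \<and> C \<inter> D = {} \<and>
        vset (ugraph \<Omega>) C \<inter> vset (ugraph \<Omega>) D = {x} \<and> X = C \<union> D"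
    | "\<exists>C D P x y. unbalanced_cycle \<Omega> C \<and> unbalanced_cycle \<Omega> D \<and>
        vset (ugraph \<Omega>) C \<inter> vset (ugraph \<Omega>) D = {} \<and>
        path_between (ugraph \<Omega>) x y P \<and> vset (ugraph \<Omega>) P \<inter> vset (ugraph \<Omega>) C = {x} \<and>
        vset (ugraph \<Omega>) P \<inter> vset (ugraph \<Omega>) D = {y} \<and> X = C \<union> D \<union> P"
    | "theta (ugraph \<Omega>) X" "\<forall>C. cycle (ugraph \<Omega>) C \<and> C \<subseteq> X \<longrightarrow> unbalanced_cycle \<Omega> C"
    using assms(1) unfolding frame_circuit_iff by blast
  then show thesis
  proof cases
    case 1
    then show ?thesis using that(1) assms(2) unfolding biased_graph_def by blast
  next
    case 2
    then show ?thesis using that(2) unfolding unbalanced_cycle_def by blast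
  next
    case 3
    then show ?thesis using that(3) unfolding unbalanced_cycle_def by blast
  next
    case 4
    from 4(1) obtain x y P Q R where "x \<noteq> y" "path_between (ugraph \<Omega>) x y P"
      "path_between (ugraph \<Omega>) x y Q"
      "path_between (ugraph \<Omega>) x y R" "P \<inter> Q = {}" "P \<inter> R = {}" "Q \<inter> R = {}" "X = P \<union> Q \<union> R"
      unfolding theta_def by blast
    then show ?thesis using that(4) 4 by blast
  qed
qed

lemma frame_circuit_linked:
  assumes "frame_circuit \<Omega> X" "biased_graph \<Omega>"
  shows "linked (ugraph \<Omega>) X"
  using assms
proof (cases rule: frame_circuit_cases)
  case balanced
  then show ?thesis by (intro cycle_linked)
next
  case (tight C D x)
  then show ?thesis by (metis IntD1 IntD2 cycle_linked linked_Un singletonI)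
next
  case (loose C D P x y)
  have "linked (ugraph \<Omega>) (C \<union> P)"
    using linked_Un[OF cycle_linked[OF loose(8)] path_between_linked[OF loose(4)], of x] loose(5) by auto
  then have "linked (ugraph \<Omega>) ((C \<union> P) \<union> D)"
    using linked_Un[OF _ cycle_linked[OF loose(9)], of "C \<union> P" y] loose(6) by (auto simp: vset_Un)
  then show ?thesis using loose by (simp add: Un_ac)
next
  case (theta x y P Q R)
  have x: "x \<in> vset (ugraph \<Omega>) P" "x \<in> vset (ugraph \<Omega>) Q" "x \<in> vset (ugraph \<Omega>) R"
    using theta(2-4) by (auto dest: path_between_vset)
  have "linked (ugraph \<Omega>) (P \<union> Q)"
    by (rule linked_Un[OF path_between_linked[OF theta(2)] path_between_linked[OF theta(3)] x(1,2)])
  then have "linked (ugraph \<Omega>) ((P \<union> Q) \<union> R)"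
    using linked_Un[OF _ path_between_linked[OF theta(4)] _ x(3), of "P \<union> Q"] x(1)
    by (auto simp: vset_Un)
  then show ?thesis using theta by simp
qed

text \<open>Frame circuits have no vertex of degree one. A loop in a circuit shares its vertex with
  another part of that circuit, except for a balanced loop, which \<open>X \<noteq> {e}\<close>
  excludes.\<close>

lemma frame_circuit_other_edge:
  assumes "frame_circuit \<Omega> X" "biased_graph \<Omega>" "e \<in> X" "w \<in> ends (ugraph \<Omega>) e" "X \<noteq> {e}"
  shows "\<exists>f\<in>X - {e}. w \<in> ends (ugraph \<Omega>) f"
  using assms(1,2)
proof (cases rule: frame_circuit_cases)
  case balanced
  then show ?thesis using cycle_other_edge[of "ugraph \<Omega>" X e w] assms by auto
next
  case (tight C D x)
  have main: "\<exists>f\<in>(A \<union> B) - {e}. w \<in> ends (ugraph \<Omega>) f"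
    if "cycle (ugraph \<Omega>) A" "e \<in> A" "A \<inter> B = {}" "vset (ugraph \<Omega>) A \<inter> vset (ugraph \<Omega>) B = {x}" for A B
    using cycle_other_edge[OF that(1,2) assms(4)]
  proof
    assume A: "A = {e} \<and> ends (ugraph \<Omega>) e = {w}"
    then have "w \<in> vset (ugraph \<Omega>) B" using that(4) by (auto simp: vset_def)
    then show ?thesis using that A by (auto simp: vset_def)
  qed auto
  show ?thesis using main[of C D] main[of D C] tight assms(3) by (auto simp: Int_commute)
next
  case (loose C D P x y)
  have main: "\<exists>f\<in>(A \<union> P) - {e}. w \<in> ends (ugraph \<Omega>) f"
    if "cycle (ugraph \<Omega>) A" "e \<in> A" "vset (ugraph \<Omega>) P \<inter> vset (ugraph \<Omega>) A = {z}" for A z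
    using cycle_other_edge[OF that(1,2) assms(4)]
  proof
    assume A: "A = {e} \<and> ends (ugraph \<Omega>) e = {w}"
    then have "w \<in> vset (ugraph \<Omega>) P" using that(3) by (auto simp: vset_def)
    then obtain f where "f \<in> P" "w \<in> ends (ugraph \<Omega>) f" by (auto simp: vset_def)
    moreover have "e \<notin> P" using path_between_nonloop[OF loose(4), of e w] A by auto
    ultimately show ?thesis by auto
  qed auto
  have end_edge: "\<exists>f\<in>A - {e}. z \<in> ends (ugraph \<Omega>) f"
    if "e \<in> P" "vset (ugraph \<Omega>) P \<inter> vset (ugraph \<Omega>) A = {z}" for A z
  proof -
    have "e \<notin> A"
      using path_between_nonloop[OF loose(4) that(1), of z] that by (auto simp: vset_def)
    moreover have "z \<in> vset (ugraph \<Omega>) A" using that by auto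
    ultimately show ?thesis by (auto simp: vset_def)
  qed
  consider "e \<in> C" | "e \<in> D" | "e \<in> P" using loose assms(3) by auto
  then show ?thesis
  proof cases
    case 1
    then show ?thesis using main[of C x] loose by auto
  next
    case 2
    then show ?thesis using main[of D y] loose by auto
  next
    case 3
    then consider "w = x" | "w = y" | "\<exists>f\<in>P - {e}. w \<in> ends (ugraph \<Omega>) f"
      using path_between_other_edge[OF loose(4) 3 assms(4)] by auto
    then show ?thesis using end_edge[OF 3, of C x] end_edge[OF 3, of D y] loose by cases auto
  qed
next
  case (theta x y P Q R)
  have main: "\<exists>f\<in>(A \<union> B) - {e}. w \<in> ends (ugraph \<Omega>) f"
    if "path_between (ugraph \<Omega>) x y A" "path_between (ugraph \<Omega>) x y B" "e \<in> A" "A \<inter> B = {}" for A B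
  proof (cases "w = x \<or> w = y")
    case True
    then have "w \<in> vset (ugraph \<Omega>) B" using path_between_vset[OF that(2)] by auto
    then show ?thesis using that by (auto simp: vset_def)
  next
    case False
    then show ?thesis using path_between_other_edge[OF that(1,3) assms(4)] by auto
  qed
  show ?thesis using main[of P Q] main[of Q P] main[of R P] theta assms(3) by (auto simp: Int_commute)
qed

text \<open>All other kinds of circuit properly contain a cycle, which minimality of cycles
  forbids.\<close>

lemma frame_circuit_cycle_balanced:
  assumes "frame_circuit \<Omega> C" "biased_graph \<Omega>" "cycle (ugraph \<Omega>) C"
  shows "C \<in> balanced_cycles \<Omega>"
  using assms(1,2)
proof (cases rule: frame_circuit_cases)
  case (tight A D x)
  have "A = C" "D = C"
    by (rule cycle_subset_cycle[OF assms(3)]; use tight(5-7) in blast)+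
  then show ?thesis using tight(3) cycle_nonempty[OF assms(3)] by simp
next
  case (loose A D P x y)
  have "A = C" "D = C"
    by (rule cycle_subset_cycle[OF assms(3)]; use loose(7-9) in blast)+
  then show ?thesis using loose(3,5) by blast
next
  case (theta x y P Q R)
  then show ?thesis using theta_cycle[OF theta(9)] cycle_subset_cycle[OF assms(3)] by blast
qed

text \<open>This is spanning in the frame matroid: a connected set with an unbalanced cycle spans
  every edge on its vertices, and a connected set that stays balanced with \<open>e\<close> added
  spans \<open>e\<close>. The cycle closed by \<open>e\<close> through \<open>Y\<close> is a circuit
  if balanced; otherwise it is combined with an unbalanced cycle \<open>D\<close> of
  \<open>Y\<close>, depending on whether they share no, one or several vertices.\<close>

lemma frame_circuit_through:
  assumes "biased_graph \<Omega>" "linked (ugraph \<Omega>) Y" "Y \<subseteq> edges (ugraph \<Omega>)"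
    "e \<in> edges (ugraph \<Omega>)" "e \<notin> Y" "ends (ugraph \<Omega>) e \<subseteq> vset (ugraph \<Omega>) Y"
    "(\<exists>D\<subseteq>Y. unbalanced_cycle \<Omega> D) \<or>
      (\<forall>C. cycle (ugraph \<Omega>) C \<and> C \<subseteq> insert e Y \<longrightarrow> C \<in> balanced_cycles \<Omega>)"
  shows "\<exists>C. frame_circuit \<Omega> C \<and> e \<in> C \<and> C \<subseteq> insert e Y"
proof -
  let ?G = "ugraph \<Omega>"
  have gr: "graph ?G" using assms(1) by (simp add: biased_graph_def)
  then obtain a b where ab: "ends ?G e = {a, b}"
    using assms(4) unfolding graph_def by (metis card_1_singletonE card_2_iff insert_absorb2)
  obtain vs es where p: "path ?G vs es" "hd vs = a" "last vs = b" "set es \<subseteq> Y"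
    using reach_path[of a b ?G Y] assms ab unfolding linked_def by auto
  have e: "e \<notin> set es" using p assms by auto
  let ?C = "insert e (set es)"
  have C: "cycle ?G ?C" using cycleI[OF p(1) assms(4) e] ab p by auto
  have VC: "vset ?G ?C = set vs" using vset_closed_path[OF p(1)] ab p by auto
  show ?thesis
  proof (cases "?C \<in> balanced_cycles \<Omega>")
    case True
    then have "frame_circuit \<Omega> ?C" by (rule frame_circuit_balancedI)
    then show ?thesis using p by blast
  next
    case False
    then have uC: "unbalanced_cycle \<Omega> ?C" using C by (simp add: unbalanced_cycle_def)
    have "?C \<subseteq> insert e Y" using p by auto
    then obtain D where D: "D \<subseteq> Y" "unbalanced_cycle \<Omega> D" using assms(7) False C by blast
    have cD: "cycle ?G D" using D by (simp add: unbalanced_cycle_def)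
    have eD: "e \<notin> D" using D assms by auto
    \<comment> \<open>An edge of the path is not a loop, so it cannot belong to \<open>D\<close>
      when it has at most one vertex in common with \<open>D\<close>.\<close>
    have one: "f \<notin> D" if "f \<in> set es" "ends ?G f \<inter> vset ?G D \<subseteq> {z}" for f z
      using that path_nonloop[OF p(1) that(1), of z] by (auto simp: vset_def)
    consider "set vs \<inter> vset ?G D = {}" | z where "set vs \<inter> vset ?G D = {z}"
      | x y where "x \<noteq> y" "x \<in> set vs \<inter> vset ?G D" "y \<in> set vs \<inter> vset ?G D" by blast
    then show ?thesis
    proof cases
      case 1
      have "vset ?G D \<noteq> {}"
        using cD vset_closed_path path_nonempty by (metis cycleE set_empty)
      then obtain d where d: "d \<in> vset ?G D" by blast
      have aC: "a \<in> set vs" using p path_nonempty[OF p(1)] by auto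
      have aY: "a \<in> vset ?G Y" using ab assms(6) by auto
      have dY: "d \<in> vset ?G Y" using d vset_mono[OF D(1), of ?G] by blast
      obtain x y P where P: "path_between ?G x y P" "P \<subseteq> Y"
        "vset ?G P \<inter> set vs = {x}" "vset ?G P \<inter> vset ?G D = {y}"
        using path_between_sets[OF assms(2,3) 1 aC aY d dY] by blast
      then have "frame_circuit \<Omega> (?C \<union> D \<union> P)"
        using frame_circuit_looseI[OF uC D(2)] 1 VC by simp
      then show ?thesis using P D p by blast
    next
      case (2 z)
      have "f \<notin> D" if "f \<in> set es" for f
        using one[OF that, of z] path_vset_subset[OF p(1)] that 2 by (auto simp: vset_def)
      then have "?C \<inter> D = {}" using eD by auto
      then have "frame_circuit \<Omega> (?C \<union> D)"
        using frame_circuit_tightI[OF uC D(2)] 2 VC by simp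
      then show ?thesis using D p by blast
    next
      case (3 x0 y0)
      \<comment> \<open>The part \<open>Q\<close> of the cycle around \<open>e\<close> up to the first vertices of \<open>D\<close> forms a theta graph with
        \<open>D\<close>. Its only cycle that misses \<open>e\<close> is \<open>D\<close>, so it is a circuit or contains a balanced cycle
        through \<open>e\<close>.\<close>
      obtain A x R where x: "vs = A @ x # R" "x \<in> vset ?G D" "\<forall>z\<in>set A. z \<notin> vset ?G D"
        using split_list_first_prop[of vs "\<lambda>z. z \<in> vset ?G D"] 3 by blast
      have "\<exists>y\<in>set R. y \<in> vset ?G D" using 3 x by auto
      from split_list_last_prop[OF this] obtain B y T where
        y: "R = B @ y # T" "y \<in> vset ?G D" "\<forall>z\<in>set T. z \<notin> vset ?G D" by blast
      have vs: "vs = A @ x # B @ y # T" using x y by simp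
      then have xy: "x \<noteq> y" using path_distinct[OF p(1)] by auto
      obtain P Q where Q: "path_between ?G x y Q" "P \<union> Q = ?C" "e \<in> Q"
        "vset ?G Q = insert x (insert y (set A \<union> set T))"
        "\<forall>f\<in>Q - {e}. ends ?G f \<subseteq> insert x (set A) \<or> ends ?G f \<subseteq> insert y (set T)"
        using cycle_split[OF p(1)[unfolded vs] assms(4) e] ab p(2,3) vs by auto
      have QD: "Q \<inter> D = {}"
      proof -
        have "f \<notin> D" if "f \<in> Q" "f \<noteq> e" for f
        proof -
          have "f \<in> set es" using that Q(2) by auto
          moreover have "ends ?G f \<inter> vset ?G D \<subseteq> {x} \<or> ends ?G f \<inter> vset ?G D \<subseteq> {y}"
            using Q(5) that x(3) y(3) by auto
          ultimately show ?thesis using one by blast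
        qed
        then show ?thesis using eD by auto
      qed
      have VQD: "vset ?G Q \<inter> vset ?G D = {x, y}" using Q(4) x y by auto
      obtain P1 P2 where D12: "path_between ?G x y P1" "path_between ?G x y P2" "P1 \<inter> P2 = {}"
        "P1 \<union> P2 = D" "vset ?G P1 \<inter> vset ?G P2 = {x, y}"
        using cycle_two_paths[OF cD x(2) y(2) xy] by blast
      have VD: "vset ?G D = vset ?G P1 \<union> vset ?G P2" using D12(4) vset_Un[of ?G P1 P2] by simp
      have disj: "Q \<inter> P1 = {}" "Q \<inter> P2 = {}" using QD D12(4) by auto
      have "vset ?G Q \<inter> vset ?G P1 = {x, y}" "vset ?G Q \<inter> vset ?G P2 = {x, y}"
        using VQD VD path_between_vset[OF D12(1)] path_between_vset[OF D12(2)] by auto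
      then have "theta ?G (Q \<union> P1 \<union> P2)"
        using thetaI[OF xy Q(1) D12(1,2) disj D12(3) _ _ D12(5)] by blast
      then have th: "theta ?G (Q \<union> D)" unfolding Un_assoc D12(4) .
      have sub: "Q \<union> D \<subseteq> insert e Y" using Q(2) p D by auto
      show ?thesis
      proof (cases "\<forall>C. cycle ?G C \<and> C \<subseteq> Q \<union> D \<longrightarrow> unbalanced_cycle \<Omega> C")
        case True
        then have "frame_circuit \<Omega> (Q \<union> D)" by (rule frame_circuit_thetaI[OF th])
        then show ?thesis using sub Q(3) by blast
      next
        case False
        then obtain C' where C': "cycle ?G C'" "C' \<subseteq> Q \<union> D" "C' \<in> balanced_cycles \<Omega>"
          by (auto simp: unbalanced_cycle_def)
        obtain us fs where Qp: "path ?G us fs" "hd us = x" "last us = y" "Q = set fs"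
          using Q(1) unfolding path_between_iff by blast
        have "set fs \<subseteq> C' \<or> set fs \<inter> C' = {}"
        proof (rule path_all_or_nothing[OF Qp(1)])
          fix g w assume g: "g \<in> C'" "g \<in> set fs" "w \<in> ends ?G g" "w \<noteq> hd us" "w \<noteq> last us"
          have "\<exists>f\<in>C' - {g}. w \<in> ends ?G f"
            using cycle_other_edge[OF C'(1) g(1,3)] path_nonloop[OF Qp(1) g(2)] by auto
          moreover have "w \<notin> vset ?G D"
            using VQD g Qp by (auto simp: vset_def)
          ultimately show "\<exists>f\<in>C' \<inter> set fs - {g}. w \<in> ends ?G f"
            using C'(2) Qp(4) by (auto simp: vset_def)
        qed
        then have "e \<in> C' \<or> C' \<subseteq> D" using C'(2) Q(3) Qp(4) by auto
        moreover have "\<not> C' \<subseteq> D"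
          using cycle_subset_cycle[OF cD C'(1)] C'(3) D(2) by (auto simp: unbalanced_cycle_def)
        moreover have "frame_circuit \<Omega> C'" using C'(3) by (rule frame_circuit_balancedI)
        ultimately show ?thesis using C'(2) sub by blast
      qed
    qed
  qed
qed

section \<open>Edges and cycles of \<open>G\<close> that avoid a few vertices\<close>

section \<open>Four-connected graphs\<close>

definition star :: "('v, 'e) mgraph \<Rightarrow> 'v \<Rightarrow> 'e set" where
  "star G v = {e \<in> edges G. v \<in> ends G e}"

definition avoiding :: "('v, 'e) mgraph \<Rightarrow> 'v set \<Rightarrow> 'e set" where
  "avoiding G X = {e \<in> edges G. ends G e \<inter> X = {}}"

lemma avoiding_subset: "avoiding G X \<subseteq> edges G"
  by (auto simp: avoiding_def)

lemma avoiding_empty [simp]: "avoiding G {} = edges G"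
  by (auto simp: avoiding_def)

lemma four_connected_edge:
  assumes "four_connected_ge5 G" "e \<in> edges G"
  obtains x y where "ends G e = {x, y}" "x \<noteq> y" "x \<in> verts G" "y \<in> verts G"
proof -
  have "card (ends G e) = 2" "ends G e \<subseteq> verts G"
    using assms unfolding four_connected_ge5_def graph_def loopless_def by auto
  then show thesis using that unfolding card_2_iff by auto
qed

lemma four_connected_edge_at:
  assumes "four_connected_ge5 G" "e \<in> edges G" "x \<in> ends G e"
  obtains y where "ends G e = {x, y}" "x \<noteq> y" "x \<in> verts G" "y \<in> verts G"
  using four_connected_edge[OF assms(1,2)] assms(3) by (metis doubleton_eq_iff insertE singletonD)

lemma four_connected_reach:
  assumes "four_connected_ge5 G" "finite X" "card X \<le> 3" "a \<in> verts G - X" "b \<in> verts G - X"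
  shows "(a, b) \<in> (adj G (avoiding G X))\<^sup>*"
proof -
  \<comment> \<open>The set \<open>X\<close> may contain points outside \<open>G\<close>, whereas
    the connectivity hypothesis speaks of subsets of \<open>verts G\<close>.\<close>
  have "card (X \<inter> verts G) \<le> 3"
    using card_mono[OF assms(2), of "X \<inter> verts G"] assms(3) by auto
  then have "connected_graph (delete_verts G (X \<inter> verts G))"
    using assms(1) unfolding four_connected_ge5_def by auto
  then have "(a, b) \<in> (adj G {e \<in> edges G. ends G e \<inter> (X \<inter> verts G) = {}})\<^sup>*"
    using assms(4,5) unfolding connected_graph_def delete_verts_def adj_def by auto
  moreover have "{e \<in> edges G. ends G e \<inter> (X \<inter> verts G) = {}} \<subseteq> avoiding G X"
    using assms(1) unfolding four_connected_ge5_def graph_def avoiding_def by auto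
  ultimately show ?thesis by (rule adj_rtrancl_mono)
qed

text \<open>The five vertices enter here: \<open>X\<close> and \<open>v\<close> are at most four, so
  a further vertex remains, and the first edge of a walk to it in \<open>G - X\<close> is the one
  wanted.\<close>

lemma four_connected_star_avoiding:
  assumes "four_connected_ge5 G" "finite X" "card X \<le> 3" "v \<in> verts G" "v \<notin> X"
  obtains e where "e \<in> avoiding G X" "v \<in> ends G e"
proof -
  have fin: "finite (verts G)" and "card (verts G) \<ge> 5"
    using assms(1) unfolding four_connected_ge5_def graph_def by auto
  then have "card (insert v X) < card (verts G)"
    using assms(2,3) card_insert_le_m1[of 4 X v] by (simp add: card_insert_if)
  then have "\<not> verts G \<subseteq> insert v X"
    using card_mono[of "insert v X" "verts G"] assms(2) by auto
  then obtain b where b: "b \<in> verts G" "b \<notin> X" "b \<noteq> v" by auto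
  have "(v, b) \<in> (adj G (avoiding G X))\<^sup>*"
    using four_connected_reach[OF assms(1-3)] assms(4,5) b by auto
  then obtain c where "(v, c) \<in> adj G (avoiding G X)"
    using b(3) by (metis converse_rtranclE)
  then show thesis using that by (auto simp: adj_def)
qed

text \<open>The far ends \<open>a\<close> and \<open>c\<close> of the two edges stay connected after
  deleting \<open>X\<close> and \<open>b\<close>, at most three vertices in all. For parallel edges
  \<open>a = c\<close> and the joining path is trivial.\<close>

lemma four_connected_fan_cycle:
  assumes "four_connected_ge5 G" "finite X" "card X \<le> 2"
    "e \<in> avoiding G X" "f \<in> avoiding G X" "b \<in> ends G e" "b \<in> ends G f" "e \<noteq> f"
  obtains C where "cycle G C" "C \<subseteq> avoiding G X" "C \<inter> star G b = {e, f}"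
proof -
  have E: "e \<in> edges G" "f \<in> edges G" using assms(4,5) by (auto simp: avoiding_def)
  obtain a where a: "ends G e = {b, a}" "b \<noteq> a" "a \<in> verts G"
    using four_connected_edge_at[OF assms(1) E(1) assms(6)] by metis
  obtain c where c: "ends G f = {b, c}" "b \<noteq> c" "c \<in> verts G"
    using four_connected_edge_at[OF assms(1) E(2) assms(7)] by metis
  have "a \<notin> insert b X" "c \<notin> insert b X" using a c assms(4,5) by (auto simp: avoiding_def)
  then have "(a, c) \<in> (adj G (avoiding G (insert b X)))\<^sup>*"
    using four_connected_reach[OF assms(1), of "insert b X" a c] assms(2,3) a c
    by (simp add: card_insert_if)
  from reach_path[OF this avoiding_subset] obtain vs es where
    p: "path G vs es" "hd vs = a" "last vs = c" "set es \<subseteq> avoiding G (insert b X)" by blast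
  have "b \<notin> set vs"
  proof (cases "es = []")
    case True
    then have "vs = [a]" using p by (auto elim: path.cases)
    then show ?thesis using a by auto
  next
    case False
    then show ?thesis using path_vset[OF p(1)] p(4) by (auto simp: vset_def avoiding_def)
  qed
  then have path: "path G (b # vs) (e # es)" using p a E by (intro path.Cons) auto
  have f: "f \<notin> set (e # es)" using assms(7,8) p(4) by (auto simp: avoiding_def)
  have "cycle G (insert f (set (e # es)))"
    using cycleI[OF path E(2) f] c p path_nonempty[OF p(1)] by auto
  moreover have "insert f (set (e # es)) \<subseteq> avoiding G X"
    using p(4) assms(4,5) by (auto simp: avoiding_def)
  moreover have "insert f (set (e # es)) \<inter> star G b = {e, f}"
    using p(4) assms(6,7) E by (auto simp: avoiding_def star_def)
  ultimately show thesis by (rule that)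
qed

lemma four_connected_cycle_other_edge:
  assumes "four_connected_ge5 G" "cycle G C" "e \<in> C" "w \<in> ends G e"
  shows "\<exists>f\<in>C - {e}. w \<in> ends G f"
proof -
  have "e \<in> edges G" using cycle_edges[OF assms(2)] assms(3) by auto
  then have "ends G e \<noteq> {w}"
    using four_connected_edge[OF assms(1)] by (metis doubleton_eq_iff insert_absorb2)
  then show ?thesis using cycle_other_edge[OF assms(2-4)] by auto
qed

text \<open>Without loops the degree is zero or two. This is the source of the sign condition: when
  the edges labelled -1 are a star of \<open>G\<close>, every cycle of \<open>G\<close> contains
  evenly many of them.\<close>

lemma four_connected_cycle_even_degree:
  assumes "four_connected_ge5 G" "cycle G C"
  shows "even (card (C \<inter> star G v))"
proof -
  have eq: "C \<inter> star G v = {e \<in> C. v \<in> ends G e}"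
    using cycle_edges[OF assms(2)] by (auto simp: star_def)
  have "card (C \<inter> star G v) \<noteq> 1"
  proof
    assume "card (C \<inter> star G v) = 1"
    then obtain e where e: "C \<inter> star G v = {e}" by (auto simp: card_1_singleton_iff)
    then obtain f where "f \<in> C - {e}" "v \<in> ends G f"
      using four_connected_cycle_other_edge[OF assms, of e v] eq by auto
    then show False using e eq by auto
  qed
  moreover have "card (C \<inter> star G v) \<le> 2" using cycle_degree_le[OF assms(2), of v] eq by simp
  ultimately have "card (C \<inter> star G v) = 0 \<or> card (C \<inter> star G v) = 2" by linarith
  then show ?thesis by auto
qed

text \<open>In a separation at \<open>c\<close>, each side has a vertex other than \<open>c\<close>
  because no edge is a loop, yet a walk in \<open>G - c\<close> can never change sides.\<close>

lemma four_connected_two_connected: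
  assumes "four_connected_ge5 G"
  shows "two_connected G"
proof -
  have g: "graph G" "connected_graph G" using assms by (auto simp: four_connected_ge5_def)
  have "\<not> card (vset G A \<inter> vset G B) = 1"
    if AB: "A \<noteq> {}" "B \<noteq> {}" "A \<inter> B = {}" "A \<union> B = edges G" for A B
  proof
    assume "card (vset G A \<inter> vset G B) = 1"
    then obtain c where c: "vset G A \<inter> vset G B = {c}" by (auto simp: card_1_singleton_iff)
    have other: "\<exists>v\<in>vset G S - {c}. v \<in> verts G" if S: "S \<noteq> {}" "S \<subseteq> edges G" for S
    proof -
      obtain e where e: "e \<in> S" "e \<in> edges G" using S by auto
      obtain x y where "ends G e = {x, y}" "x \<noteq> y" "x \<in> verts G" "y \<in> verts G"
        using four_connected_edge[OF assms e(2)] .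
      then show ?thesis using e by (auto simp: vset_def)
    qed
    obtain a where a: "a \<in> vset G A" "a \<noteq> c" "a \<in> verts G" using other[of A] AB by auto
    obtain b where b: "b \<in> vset G B" "b \<noteq> c" "b \<in> verts G" using other[of B] AB by auto
    have "(a, b) \<in> (adj G (avoiding G {c}))\<^sup>*"
      using four_connected_reach[OF assms, of "{c}"] a b by auto
    then have "b \<in> vset G A - {c}"
    proof (induction rule: rtrancl_induct)
      case base
      show ?case using a by auto
    next
      case (step y z)
      then obtain e where e: "e \<in> avoiding G {c}" "ends G e = {y, z}" by (auto simp: adj_def)
      then have "e \<in> A \<or> e \<in> B" using AB by (auto simp: avoiding_def)
      moreover have "e \<notin> B" using step.IH e c by (auto simp: vset_def)
      ultimately show ?case using e by (auto simp: vset_def avoiding_def)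
    qed
    then show False using b c by auto
  qed
  then have "nonseparable G" using g unfolding nonseparable_def verts_restrict_edges by blast
  then show ?thesis
    using g unfolding two_connected_def block_of_def subgraph_def by auto
qed

section \<open>Renaming vertices\<close>

text \<open>The map \<open>g\<close> leads from the constructed graph \<open>B\<close> to the
  underlying graph of \<Omega>, the direction in which it arises; \<open>same_graph\<close> asks for
  its inverse.\<close>

lemma same_graphI:
  assumes "edges A = edges B" "bij_betw g (verts B) (verts A)"
    "\<And>e. e \<in> edges B \<Longrightarrow> ends B e \<subseteq> verts B" "\<And>e. e \<in> edges B \<Longrightarrow> ends A e = g ` ends B e"
  shows "same_graph A B"
proof -
  have inj: "inj_on g (verts B)" using assms(2) by (rule bij_betw_imp_inj_on)
  show ?thesis
    unfolding same_graph_def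
    using assms(1,4) bij_betw_inv_into[OF assms(2)] inv_into_image_cancel[OF inj assms(3)]
    by (intro conjI exI[of _ "inv_into (verts B) g"]) auto
qed

lemma cycle_rename:
  assumes "inj_on g (verts B)" "edges A = edges B"
    "\<And>e. e \<in> edges B \<Longrightarrow> ends B e \<subseteq> verts B" "\<And>e. e \<in> edges B \<Longrightarrow> ends A e = g ` ends B e"
    "cycle B C"
  shows "cycle A C"
proof -
  obtain vs es where *: "es \<noteq> []" "length vs = length es" "distinct vs" "distinct es"
    "C = set es" "C \<subseteq> edges B"
    "\<forall>i<length es. ends B (es ! i) = {vs ! i, vs ! (Suc i mod length es)}"
    using assms(5) unfolding cycle_def by blast
  have es: "es ! i \<in> edges B" if "i < length es" for i using * that by auto
  have "set vs \<subseteq> verts B"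
  proof
    fix v assume "v \<in> set vs"
    then obtain i where i: "i < length es" "v = vs ! i" using * by (metis in_set_conv_nth)
    then show "v \<in> verts B" using *(7) assms(3)[OF es[OF i(1)]] by auto
  qed
  then have "distinct (map g vs)"
    using *(3) assms(1) by (auto simp: distinct_map intro: inj_on_subset)
  moreover have "ends A (es ! i) = {map g vs ! i, map g vs ! (Suc i mod length es)}"
    if "i < length es" for i
  proof -
    have "Suc i mod length es < length vs" using *(1,2) by simp
    then show ?thesis using that * assms(4)[OF es[OF that]] by auto
  qed
  ultimately show ?thesis
    unfolding cycle_def using * assms(2) by (intro exI[of _ "map g vs"] exI[of _ es]) auto
qed

lemma cycle_rename_iff:
  assumes "edges A = edges B" "bij_betw g (verts B) (verts A)"
    "\<And>e. e \<in> edges B \<Longrightarrow> ends B e \<subseteq> verts B" "\<And>e. e \<in> edges B \<Longrightarrow> ends A e = g ` ends B e"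
  shows "cycle A C \<longleftrightarrow> cycle B C"
proof
  have inj: "inj_on g (verts B)" using assms(2) by (rule bij_betw_imp_inj_on)
  show "cycle B C \<Longrightarrow> cycle A C" by (rule cycle_rename[OF inj assms(1,3,4)])
  have inj': "inj_on (inv_into (verts B) g) (verts A)"
    using bij_betw_inv_into[OF assms(2)] by (rule bij_betw_imp_inj_on)
  show "cycle B C" if "cycle A C"
  proof (rule cycle_rename[OF inj' _ _ _ that])
    show "edges B = edges A" using assms(1) by simp
    show "ends A e \<subseteq> verts A" if "e \<in> edges A" for e
      using that assms bij_betw_imp_surj_on[OF assms(2)] by blast
    show "ends B e = inv_into (verts B) g ` ends A e" if "e \<in> edges A" for e
      using that assms(1,4) inv_into_image_cancel[OF inj assms(3)] by simp
  qed
qed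

section \<open>Graphic frame matroids\<close>

locale graphic_frame =
  fixes G :: "('v, 'e) mgraph" and \<Omega> :: "('w, 'e) bgraph"
  assumes four: "four_connected_ge5 G"
    and bias: "biased_graph \<Omega>"
    and no_isolated: "no_isolated_verts (ugraph \<Omega>)"
    and matroid_eq: "frame_matroid \<Omega> = cycle_matroid G"
begin

section \<open>Circuits and connectedness carried from \<open>G\<close> to \<Omega>\<close>

abbreviation H :: "('w, 'e) mgraph" where "H \<equiv> ugraph \<Omega>"

lemma edges_H [simp]: "edges H = edges G"
  using matroid_eq by (simp add: frame_matroid_def cycle_matroid_def)

lemma frame_circuit_iff_cycle: "frame_circuit \<Omega> C \<longleftrightarrow> cycle G C"
  using matroid_eq by (auto simp: frame_matroid_def cycle_matroid_def set_eq_iff)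

lemma balanced_iff_cycle: "cycle H C \<Longrightarrow> C \<in> balanced_cycles \<Omega> \<longleftrightarrow> cycle G C"
  using frame_circuit_cycle_balanced[OF _ bias] frame_circuit_balancedI frame_circuit_iff_cycle
  by blast

lemma finite_G: "finite (verts G)"
  using four by (simp add: four_connected_ge5_def graph_def)

lemma ends_H: "e \<in> edges G \<Longrightarrow> ends H e \<subseteq> verts H \<and> ends H e \<noteq> {} \<and> card (ends H e) \<le> 2"
  using bias unfolding biased_graph_def graph_def by auto

lemma ends_H_eq:
  assumes "e \<in> edges G" "p \<in> ends H e" "q \<in> ends H e" "p \<noteq> q"
  shows "ends H e = {p, q}"
proof -
  have "finite (ends H e)"
    using bias assms(1) unfolding biased_graph_def graph_def by (auto intro: finite_subset)
  then show ?thesis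
    using card_seteq[of "ends H e" "{p, q}"] assms ends_H[OF assms(1)] by auto
qed

text \<open>Two edges of \<open>G - X\<close> at a vertex \<open>b\<close> lie in a common cycle of
  \<open>G - X\<close>, which is a circuit and hence connected in \<Omega>. Chaining this along
  walks of \<open>G - X\<close> links all its edges. The bound 2 leaves the third deletion for
  \<open>b\<close>.\<close>

lemma linked_avoiding:
  assumes "finite X" "card X \<le> 2"
  shows "linked H (avoiding G X)"
proof -
  let ?Y = "avoiding G X"
  let ?R = "(adj H ?Y)\<^sup>*"
  have share: "(p, q) \<in> ?R"
    if ef: "e \<in> ?Y" "f \<in> ?Y" "b \<in> ends G e" "b \<in> ends G f" "p \<in> ends H e" "q \<in> ends H f" for e f b p q
  proof (cases "e = f")
    case True
    have "e \<in> edges G" using ef by (auto simp: avoiding_def)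
    then have "p = q \<or> ends H e = {p, q}" using ends_H_eq[of e p q] ef True by auto
    then show ?thesis using ef by (auto simp: adj_def)
  next
    case False
    obtain C where C: "cycle G C" "C \<subseteq> ?Y" "C \<inter> star G b = {e, f}"
      using four_connected_fan_cycle[OF four assms ef(1-4) False] .
    have "linked H C" using frame_circuit_linked[OF _ bias] C(1) frame_circuit_iff_cycle by blast
    moreover have "p \<in> vset H C" "q \<in> vset H C" using C(3) ef by (auto simp: vset_def)
    ultimately have "(p, q) \<in> (adj H C)\<^sup>*" by (auto simp: linked_def)
    then show ?thesis using C(2) by (rule adj_rtrancl_mono)
  qed
  have chain: "\<forall>f\<in>?Y. c \<in> ends G f \<longrightarrow> (\<forall>q\<in>ends H f. (p, q) \<in> ?R)"
    if "(a, c) \<in> (adj G ?Y)\<^sup>*" "e \<in> ?Y" "a \<in> ends G e" "p \<in> ends H e" for a c e p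
    using that(1)
  proof (induction rule: rtrancl_induct)
    case base
    then show ?case using share that by blast
  next
    case (step c d)
    obtain g where g: "g \<in> ?Y" "ends G g = {c, d}" using step.hyps by (auto simp: adj_def)
    have "g \<in> edges G" using g by (auto simp: avoiding_def)
    then obtain r where r: "r \<in> ends H g" using ends_H by blast
    have "(p, r) \<in> ?R" using step.IH g r by auto
    moreover have "(r, q) \<in> ?R" if "f \<in> ?Y" "d \<in> ends G f" "q \<in> ends H f" for f q
      using share[OF g(1) that(1) _ that(2) r that(3)] g(2) by auto
    ultimately show ?case by (meson rtrancl_trans)
  qed
  show ?thesis
    unfolding linked_def
  proof (intro ballI)
    fix p q assume "p \<in> vset H ?Y" "q \<in> vset H ?Y"
    then obtain e f where ef: "e \<in> ?Y" "p \<in> ends H e" "f \<in> ?Y" "q \<in> ends H f"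
      by (auto simp: vset_def)
    have E: "e \<in> edges G" "f \<in> edges G" using ef by (auto simp: avoiding_def)
    obtain a a' where a: "ends G e = {a, a'}" "a \<in> verts G"
      using four_connected_edge[OF four E(1)] by metis
    obtain c c' where c: "ends G f = {c, c'}" "c \<in> verts G"
      using four_connected_edge[OF four E(2)] by metis
    have "a \<notin> X" "c \<notin> X" using ef a c by (auto simp: avoiding_def)
    then have "(a, c) \<in> (adj G ?Y)\<^sup>*"
      using four_connected_reach[OF four assms(1), of a c] assms(2) a c by auto
    then show "(p, q) \<in> ?R" using chain[of a c e p] ef a c by auto
  qed
qed

section \<open>Matching the stars of \<open>G\<close> with stars of \<Omega>\<close>

definition matches :: "'e set \<Rightarrow> 'v \<Rightarrow> 'w \<Rightarrow> bool" where
  "matches S x w \<longleftrightarrow> (\<forall>f\<in>S. w \<in> ends H f \<longleftrightarrow> x \<in> ends G f)"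

text \<open>Edges of \<open>G - X\<close> at \<open>w\<close> are edges at \<open>x\<close>, because
  those of \<open>G - X - x\<close> miss \<open>w\<close>. For the converse, a cycle whose only
  edges at \<open>x\<close> are \<open>e\<close> and \<open>f\<close> is a circuit, so it has a
  second edge at \<open>w\<close>; that edge is at \<open>x\<close> and must be
  \<open>f\<close>.\<close>

lemma end_outside_matches:
  assumes "finite X" "card X \<le> 2" "e \<in> avoiding G X" "x \<in> ends G e" "w \<in> ends H e"
    "w \<notin> vset H (avoiding G (insert x X))"
  shows "matches (avoiding G X) x w"
  unfolding matches_def
proof
  fix f assume f: "f \<in> avoiding G X"
  show "w \<in> ends H f \<longleftrightarrow> x \<in> ends G f"
  proof
    assume "w \<in> ends H f"
    then show "x \<in> ends G f" using f assms(6) by (auto simp: vset_def avoiding_def)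
  next
    assume xf: "x \<in> ends G f"
    show "w \<in> ends H f"
    proof (cases "e = f")
      case False
      obtain C where C: "cycle G C" "C \<subseteq> avoiding G X" "C \<inter> star G x = {e, f}"
        using four_connected_fan_cycle[OF four assms(1,2,3) f assms(4) xf False] .
      have "frame_circuit \<Omega> C" using C(1) frame_circuit_iff_cycle by blast
      moreover have "e \<in> C" "C \<noteq> {e}" using C(3) False by auto
      ultimately obtain g where g: "g \<in> C" "g \<noteq> e" "w \<in> ends H g"
        using frame_circuit_other_edge[OF _ bias _ assms(5)] by blast
      then have "g \<notin> avoiding G (insert x X)" using assms(6) by (auto simp: vset_def)
      then have "g \<in> C \<inter> star G x" using g C(2) by (auto simp: avoiding_def star_def)
      then show ?thesis using C(3) g by auto
    qed (use assms in simp)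
  qed
qed

text \<open>Without a match, \<open>end_outside_matches\<close> puts all ends of
  \<open>G - X\<close> on edges of \<open>G - X - x\<close>. This refutes the third alternative;
  under the first two, the edges of \<open>G - X - x\<close> span an edge \<open>e\<close> at
  \<open>x\<close>, and the resulting cycle of \<open>G\<close> has no second edge at
  \<open>x\<close>. For \<open>X = {}\<close> the contrapositive describes hidden vertices; for a
  hidden \<open>u\<close> the balanced alternative applies with \<open>X = {u}\<close>.\<close>

lemma matching_vertex_exists:
  assumes "finite X" "card X \<le> 1" "x \<in> verts G" "x \<notin> X"
    "(\<exists>D\<subseteq>avoiding G (insert x X). unbalanced_cycle \<Omega> D) \<or>
      (\<forall>C. cycle H C \<and> C \<subseteq> avoiding G X \<longrightarrow> C \<in> balanced_cycles \<Omega>)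
      \<or> \<not> vset H (avoiding G X) \<subseteq> vset H (avoiding G (insert x X))"
  shows "\<exists>w. matches (avoiding G X) x w"
proof (rule ccontr)
  let ?Y = "avoiding G (insert x X)"
  assume none: "\<nexists>w. matches (avoiding G X) x w"
  have inside: "ends H e \<subseteq> vset H ?Y" if "e \<in> avoiding G X" for e
  proof (cases "x \<in> ends G e")
    case True
    then show ?thesis
      using end_outside_matches[OF assms(1) _ that True] assms(2) none by auto
  next
    case False
    then have "e \<in> ?Y" using that by (auto simp: avoiding_def)
    then show ?thesis by (auto simp: vset_def)
  qed
  obtain e where e: "e \<in> avoiding G X" "x \<in> ends G e"
    using four_connected_star_avoiding[OF four assms(1) _ assms(3,4)] assms(2) by auto
  have eE: "e \<in> edges H" "e \<notin> ?Y" "insert e ?Y \<subseteq> avoiding G X"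
    using e by (auto simp: avoiding_def)
  have "vset H (avoiding G X) \<subseteq> vset H ?Y" using inside unfolding vset_def by blast
  then have "(\<exists>D\<subseteq>?Y. unbalanced_cycle \<Omega> D) \<or>
      (\<forall>C. cycle H C \<and> C \<subseteq> insert e ?Y \<longrightarrow> C \<in> balanced_cycles \<Omega>)"
    using assms(5) eE(3) by (meson order_trans)
  moreover have "linked H ?Y" using assms(1,2) by (intro linked_avoiding) (auto simp: card_insert_if)
  moreover have "?Y \<subseteq> edges H" using avoiding_subset by simp
  ultimately obtain C where C: "frame_circuit \<Omega> C" "e \<in> C" "C \<subseteq> insert e ?Y"
    using frame_circuit_through[OF bias _ _ eE(1,2) inside[OF e(1)]] by blast
  then obtain f where "f \<in> C - {e}" "x \<in> ends G f"
    using four_connected_cycle_other_edge[OF four, of C e x] e frame_circuit_iff_cycle by auto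
  then show False using C(3) by (auto simp: avoiding_def)
qed

section \<open>Vertices of \<open>G\<close> whose star is not a star of \<Omega>\<close>

definition hidden :: "'v \<Rightarrow> bool" where
  "hidden u \<longleftrightarrow> u \<in> verts G \<and> (\<nexists>w. matches (edges G) u w)"

lemma hidden_balanced:
  assumes "hidden u" "cycle H C" "C \<subseteq> avoiding G {u}"
  shows "C \<in> balanced_cycles \<Omega>"
  using matching_vertex_exists[of "{}" u] assms
  by (auto simp: hidden_def unbalanced_cycle_def)

lemma hidden_spanning:
  assumes "hidden u" "z \<in> verts H"
  obtains e where "e \<in> avoiding G {u}" "z \<in> ends H e"
proof -
  have "vset H (edges G) \<subseteq> vset H (avoiding G {u})"
    using matching_vertex_exists[of "{}" u] assms(1) by (auto simp: hidden_def)
  moreover have "z \<in> vset H (edges G)"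
    using no_isolated assms(2) unfolding no_isolated_verts_def by (auto simp: vset_def)
  ultimately show thesis using that by (auto simp: vset_def)
qed

lemma hidden_matching:
  assumes "hidden u" "x \<in> verts G" "x \<noteq> u"
  shows "\<exists>w. matches (avoiding G {u}) x w"
  using matching_vertex_exists[of "{u}" x] hidden_balanced[OF assms(1)] assms(2,3) by auto

text \<open>An edge at \<open>x\<close> avoiding \<open>X\<close> and \<open>y\<close> would have
  the end \<open>w\<close> by one match and not by the other.\<close>

lemma matches_inj:
  assumes "matches (avoiding G X) x w" "matches (avoiding G X) y w" "finite X" "card X \<le> 2"
    "x \<in> verts G" "x \<notin> X"
  shows "x = y"
proof (rule ccontr)
  assume "x \<noteq> y"
  then have "x \<notin> insert y X" using assms(6) by simp
  moreover have "finite (insert y X)" "card (insert y X) \<le> 3"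
    using assms(3,4) by (simp_all add: card_insert_if)
  ultimately obtain e where "e \<in> avoiding G (insert y X)" "x \<in> ends G e"
    using four_connected_star_avoiding[OF four _ _ assms(5)] by blast
  then show False using assms(1,2) by (auto simp: matches_def avoiding_def)
qed

lemma matches_mono: "matches S x w \<Longrightarrow> T \<subseteq> S \<Longrightarrow> matches T x w"
  by (auto simp: matches_def)

text \<open>If \<open>p\<close> and \<open>q\<close> differed, all edges of \<open>G - u - v\<close>
  at \<open>x\<close> would have the ends \<open>p\<close> and \<open>q\<close> in \<Omega>. One of
  them joins \<open>x\<close> to some \<open>y\<close>, whose match \<open>r\<close> in
  \<open>G - u\<close> can then only be \<open>q\<close>. But an edge at \<open>x\<close> that
  avoids \<open>y\<close> also has the end \<open>q\<close>, against the match of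
  \<open>y\<close>.\<close>

lemma matches_agree:
  assumes "hidden u" "matches (avoiding G {u}) x p" "matches (avoiding G {v}) x q"
    "x \<in> verts G" "x \<noteq> u" "x \<noteq> v"
  shows "p = q"
proof (rule ccontr)
  assume "p \<noteq> q"
  have ends: "ends H f = {p, q}" if "f \<in> avoiding G {u, v}" "x \<in> ends G f" for f
    using that assms(2,3) \<open>p \<noteq> q\<close> by (intro ends_H_eq) (auto simp: matches_def avoiding_def)
  have small: "card {u, v} \<le> 3" "card {u, v, y} \<le> 3" for y
    by (simp_all add: card_insert_if)
  obtain f where f: "f \<in> avoiding G {u, v}" "x \<in> ends G f"
    using four_connected_star_avoiding[OF four _ small(1) assms(4)] assms(5,6) by blast
  have "f \<in> edges G" using f by (auto simp: avoiding_def)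
  then obtain y where y: "ends G f = {x, y}" "x \<noteq> y" "y \<in> verts G"
    using four_connected_edge_at[OF four _ f(2)] by metis
  then have "y \<noteq> u" using f by (auto simp: avoiding_def)
  then obtain r where r: "matches (avoiding G {u}) y r"
    using hidden_matching[OF assms(1)] y by blast
  have "r \<in> ends H f" using r f y by (auto simp: matches_def avoiding_def)
  moreover have "r \<noteq> p" using matches_inj[of "{u}" x p y] assms r y by auto
  ultimately have "r = q" using ends[OF f] by auto
  obtain g where g: "g \<in> avoiding G {u, v, y}" "x \<in> ends G g"
    using four_connected_star_avoiding[OF four _ small(2) assms(4)] assms(5,6) y(2) by blast
  have "g \<in> avoiding G {u, v}" using g by (auto simp: avoiding_def)
  then have "r \<in> ends H g" using ends[of g] g(2) \<open>r = q\<close> by auto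
  then show False using r g by (auto simp: matches_def avoiding_def)
qed

lemma no_three_hidden:
  assumes "hidden a" "hidden b" "hidden c" "a \<noteq> b" "a \<noteq> c" "b \<noteq> c"
  shows False
proof -
  have V: "a \<in> verts G" "b \<in> verts G" "c \<in> verts G" using assms by (auto simp: hidden_def)
  \<comment> \<open>A vertex has the same match after deleting either of two hidden vertices, so
    each of \<open>a\<close>, \<open>b\<close>, \<open>c\<close> receives a single match from the
    other two.\<close>
  have ex: "\<exists>p. matches (avoiding G {u}) x p \<and> matches (avoiding G {v}) x p"
    if "hidden u" "hidden v" "x \<in> verts G" "x \<noteq> u" "x \<noteq> v" for u v x
    using hidden_matching[of u x] hidden_matching[of v x] matches_agree[of u x _ v] that by metis
  obtain pa where pa: "matches (avoiding G {b}) a pa" "matches (avoiding G {c}) a pa"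
    using ex[of b c a] assms V by auto
  obtain pb where pb: "matches (avoiding G {a}) b pb" "matches (avoiding G {c}) b pb"
    using ex[of a c b] assms V by auto
  obtain pc where pc: "matches (avoiding G {a}) c pc" "matches (avoiding G {b}) c pc"
    using ex[of a b c] assms V by auto
  have ne: "pa \<noteq> pb" "pa \<noteq> pc" "pb \<noteq> pc"
    using matches_inj[of "{c}" a pa b] matches_inj[of "{b}" a pa c] matches_inj[of "{a}" b pb c]
      pa pb pc V assms(4-6) by auto
  \<comment> \<open>\<open>a\<close> being hidden, \<open>pa\<close> and \<open>a\<close> disagree on an edge, which must join \<open>b\<close> and \<open>c\<close>;
    this edge then has the three distinct ends \<open>pa\<close>, \<open>pb\<close>, \<open>pc\<close> in \<open>\<Omega>\<close>.\<close>
  obtain e where e: "e \<in> edges G" "(pa \<in> ends H e) \<noteq> (a \<in> ends G e)"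
    using assms(1) unfolding hidden_def matches_def by blast
  then have bc: "b \<in> ends G e" "c \<in> ends G e"
    using pa by (auto simp: matches_def avoiding_def)
  then obtain y where y: "ends G e = {b, y}"
    using four_connected_edge_at[OF four e(1)] by metis
  have "ends G e = {b, c}" using bc y assms(6) by auto
  then have "e \<in> avoiding G {a}" "pa \<in> ends H e" using e assms(4,5) by (auto simp: avoiding_def)
  moreover have "pb \<in> ends H e" "pc \<in> ends H e"
    using pb(1) pc(1) bc calculation(1) by (auto simp: matches_def)
  ultimately show False using ends_H_eq[OF e(1), of pb pc] ne by auto
qed

section \<open>The vertex map from \<open>G\<close> to \<Omega>\<close>

definition image_vertex :: "'v \<Rightarrow> 'w" where
  "image_vertex x = (SOME w. matches (edges G) x w)"

text \<open>At a hidden vertex the choice in \<open>image_vertex\<close> is arbitrary, so its values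
  are used at the other vertices only.\<close>

lemma image_vertex_matches:
  "x \<in> verts G \<Longrightarrow> \<not> hidden x \<Longrightarrow> matches (edges G) x (image_vertex x)"
  unfolding image_vertex_def hidden_def by (metis someI_ex)

lemma image_vertex_in_ends:
  "x \<in> verts G \<Longrightarrow> \<not> hidden x \<Longrightarrow> e \<in> edges G \<Longrightarrow> image_vertex x \<in> ends H e \<longleftrightarrow> x \<in> ends G e"
  using image_vertex_matches by (auto simp: matches_def)

lemma image_vertex_inj:
  assumes "x \<in> verts G" "\<not> hidden x" "y \<in> verts G" "\<not> hidden y" "image_vertex x = image_vertex y"
  shows "x = y"
  using matches_inj[of "{}" x "image_vertex y" y] image_vertex_matches[of x] image_vertex_matches[of y]
    assms by simp

lemma image_vertex_verts:
  assumes "x \<in> verts G" "\<not> hidden x"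
  shows "image_vertex x \<in> verts H"
proof -
  obtain e where "e \<in> edges G" "x \<in> ends G e"
    using four_connected_star_avoiding[OF four, of "{}" x] assms by auto
  then show ?thesis using image_vertex_in_ends[OF assms] ends_H by auto
qed

lemma ends_H_visible:
  assumes "e \<in> edges G" "\<forall>x\<in>ends G e. \<not> hidden x"
  shows "ends H e = image_vertex ` ends G e"
proof -
  obtain x y where xy: "ends G e = {x, y}" "x \<noteq> y" "x \<in> verts G" "y \<in> verts G"
    using four_connected_edge[OF four assms(1)] .
  then have "\<not> hidden x" "\<not> hidden y" using assms(2) by auto
  then have "image_vertex x \<noteq> image_vertex y" "image_vertex x \<in> ends H e" "image_vertex y \<in> ends H e"
    using image_vertex_inj[of x y] image_vertex_in_ends[of x e] image_vertex_in_ends[of y e] xy assms(1)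
    by auto
  then show ?thesis using ends_H_eq[OF assms(1)] xy(1) by simp
qed

lemma ends_G: "e \<in> edges G \<Longrightarrow> ends G e \<subseteq> verts G"
  using four by (auto simp: four_connected_ge5_def graph_def)

section \<open>Reconstruction of \<Omega> with no, one or two hidden vertices\<close>

lemma balanced_case:
  assumes "\<And>u. \<not> hidden u"
  shows "balanced \<Omega> \<and> same_graph H G"
proof -
  have ends: "ends H e = image_vertex ` ends G e" if "e \<in> edges G" for e
    using ends_H_visible[OF that] assms by blast
  have "verts H \<subseteq> image_vertex ` verts G"
  proof
    fix z assume "z \<in> verts H"
    then obtain e where "e \<in> edges G" "z \<in> ends H e"
      using no_isolated by (auto simp: no_isolated_verts_def)
    then show "z \<in> image_vertex ` verts G" using ends ends_G by blast
  qed
  then have bij: "bij_betw image_vertex (verts G) (verts H)"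
    using image_vertex_inj image_vertex_verts assms by (auto simp: bij_betw_def inj_on_def)
  have "same_graph H G" by (rule same_graphI[OF _ bij]) (use ends ends_G in auto)
  moreover have "cycle H C \<longleftrightarrow> cycle G C" for C
    by (rule cycle_rename_iff[OF _ bij]) (use ends ends_G in auto)
  ultimately show ?thesis using balanced_iff_cycle by (auto simp: balanced_def)
qed

text \<open>A balanced cycle is a cycle of \<open>G\<close> and so meets every star evenly. For a
  curling or a pinch, only the converse remains to be checked.\<close>

lemma balanced_cycles_signed:
  assumes "\<And>C. cycle H C \<longleftrightarrow> cycle B C"
    "\<And>C. cycle H C \<Longrightarrow> even (card (C \<inter> star G u)) \<Longrightarrow> C \<in> balanced_cycles \<Omega>"
  shows "balanced_cycles \<Omega> = balanced_cycles (signed_graph B {e \<in> edges G. u \<in> ends G e})"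
proof -
  have "C \<in> balanced_cycles \<Omega> \<longleftrightarrow> cycle H C \<and> even (card (C \<inter> star G u))" for C
    using assms(2) balanced_iff_cycle four_connected_cycle_even_degree[OF four] bias
    unfolding biased_graph_def by blast
  then show ?thesis using assms(1) by (auto simp: signed_graph_def star_def)
qed

lemma subset_avoiding: "C \<subseteq> edges G \<Longrightarrow> C \<inter> star G u = {} \<Longrightarrow> C \<subseteq> avoiding G {u}"
  by (auto simp: avoiding_def star_def)

text \<open>Every vertex of \<Omega> is the image of a vertex other than \<open>u\<close>, so an
  edge from \<open>u\<close> to \<open>x\<close> can only become a loop at the image of
  \<open>x\<close>.\<close>

lemma curling_case:
  assumes "hidden u" "\<And>x. hidden x \<Longrightarrow> x = u"
  shows "simple_curling_of \<Omega> G"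
proof -
  have u: "u \<in> verts G" using assms(1) by (simp add: hidden_def)
  \<comment> \<open>The neighbours of \<open>u\<close>. Each subgraph of the curling is the class of
    parallel edges between \<open>u\<close> and one neighbour.\<close>
  define N where "N = {x. \<exists>e\<in>edges G. ends G e = {u, x}}"
  have N: "N \<subseteq> verts G - {u}"
  proof
    fix x assume "x \<in> N"
    then obtain e where "e \<in> edges G" "ends G e = {u, x}" by (auto simp: N_def)
    then show "x \<in> verts G - {u}"
      using four_connected_edge[OF four, of e] by (metis Diff_iff doubleton_eq_iff insert_absorb2 singletonD)
  qed
  then have "finite N" using finite_G finite_subset by blast
  then obtain vs where vs: "bij_betw vs {..<card N} N"
    using ex_bij_betw_nat_finite by (metis atLeast0LessThan)
  define k where "k = card N"
  define Hs where "Hs i = \<lparr>verts = {u, vs i}, edges = {e \<in> edges G. ends G e = {u, vs i}}, ends = ends G\<rparr>" for i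
  have vsN: "vs i \<in> N" if "i < k" for i using vs that by (auto simp: bij_betw_def k_def)
  have vs_ex: "\<exists>i<k. vs i = x" if "x \<in> N" for x
    using vs that by (auto simp: bij_betw_def k_def image_iff) (metis imageE lessThan_iff)
  have vs_inj: "inj_on vs {..<k}" using vs by (simp add: bij_betw_def k_def)
  have edge_u: "\<exists>x\<in>N. ends G e = {u, x}" if e: "e \<in> edges G" "u \<in> ends G e" for e
  proof -
    obtain y where "ends G e = {u, y}" using four_connected_edge_at[OF four e] .
    then show ?thesis using e(1) by (auto simp: N_def)
  qed
  have data: "curling_data G u k vs Hs"
    unfolding curling_data_def
  proof (intro conjI allI impI ballI)
    show "two_connected G" by (rule four_connected_two_connected[OF four])
    show "u \<in> verts G" by (rule u)
    show "inj_on vs {..<k}" by (rule vs_inj)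
    show "vs i \<in> verts G - {u}" if "i < k" for i using vsN[OF that] N by auto
    show "subgraph (Hs i) G" if "i < k" for i
      using vsN[OF that] N u four
      by (auto simp: subgraph_def Hs_def graph_def four_connected_ge5_def)
    show "connected_graph (Hs i)" if i: "i < k" for i
    proof -
      obtain e where e: "e \<in> edges G" "ends G e = {u, vs i}" using vsN[OF i] by (auto simp: N_def)
      then have "(u, vs i) \<in> {(x, y). \<exists>e\<in>edges (Hs i). ends (Hs i) e = {x, y}}"
        "(vs i, u) \<in> {(x, y). \<exists>e\<in>edges (Hs i). ends (Hs i) e = {x, y}}"
        by (auto simp: Hs_def insert_commute)
      then show ?thesis unfolding connected_graph_def by (auto simp: Hs_def)
    qed
    show "verts (Hs i) \<inter> verts (restrict_edges G (edges G - edges (Hs i))) = {u, vs i}" if i: "i < k" for i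
    proof -
      \<comment> \<open>Each of \<open>u\<close> and \<open>vs i\<close> lies on an edge missing the
        other, that is, on an edge outside \<open>Hs i\<close>.\<close>
      have other: "\<exists>e\<in>edges G. x \<in> ends G e \<and> y \<notin> ends G e" if xy: "x \<in> verts G" "x \<noteq> y" for x y
        using four_connected_star_avoiding[OF four, of "{y}" x] xy by (auto simp: avoiding_def)
      have "vs i \<in> verts G" "vs i \<noteq> u" using vsN[OF i] N by auto
      then have "u \<in> vset G (edges G - edges (Hs i))" "vs i \<in> vset G (edges G - edges (Hs i))"
        using other[of u "vs i"] other[of "vs i" u] u by (auto simp: vset_def Hs_def)
      then show ?thesis by (auto simp: Hs_def)
    qed
    show "edges (Hs i) \<inter> edges (Hs j) = {}" if "i < k" "j < k" "i \<noteq> j" for i j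
    proof -
      have "vs i \<noteq> vs j" using vs_inj that by (auto simp: inj_on_def)
      then show ?thesis by (auto simp: Hs_def doubleton_eq_iff)
    qed
    show "\<exists>i<k. e \<in> edges (Hs i)" if "e \<in> edges G" "u \<in> ends G e" for e
      using edge_u[OF that] vs_ex that by (auto simp: Hs_def)
  qed
  let ?B = "curled_graph G u k vs Hs"
  have ends_B: "ends ?B e = ends G e - {u}" if e: "e \<in> edges G" for e
  proof (cases "u \<in> ends G e")
    case True
    then obtain x where x: "x \<in> N" "ends G e = {u, x}" using edge_u[OF e] by auto
    then have "x \<noteq> u" using N by auto
    obtain i where i: "i < k" "vs i = x" using vs_ex[OF x(1)] by auto
    \<comment> \<open>The edge lies in one parallel class only, so its end \<open>u\<close> is
      replaced by \<open>x\<close> and it becomes a loop.\<close>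
    have "{vs i | i. i < k \<and> e \<in> edges (Hs i)} = {x}"
      using i x e \<open>x \<noteq> u\<close> by (auto simp: Hs_def doubleton_eq_iff)
    then show ?thesis using x True \<open>x \<noteq> u\<close> by (auto simp: curled_graph_def)
  qed (auto simp: curled_graph_def)
  have visible: "\<not> hidden x" if "x \<noteq> u" for x using assms(2) that by blast
  \<comment> \<open>The edges of \<open>G - u\<close> meet all vertices of \<Omega>, and none of
    them has a hidden end.\<close>
  have surj: "verts H \<subseteq> image_vertex ` (verts G - {u})"
  proof
    fix z assume "z \<in> verts H"
    then obtain e where e: "e \<in> avoiding G {u}" "z \<in> ends H e"
      using hidden_spanning[OF assms(1)] by blast
    then have "ends H e = image_vertex ` ends G e"
      by (intro ends_H_visible) (auto simp: avoiding_def dest: assms(2))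
    then show "z \<in> image_vertex ` (verts G - {u})"
      using e ends_G[of e] by (auto simp: avoiding_def)
  qed
  have "inj_on image_vertex (verts G - {u})"
  proof (rule inj_onI)
    fix x y assume "x \<in> verts G - {u}" "y \<in> verts G - {u}" "image_vertex x = image_vertex y"
    then show "x = y" using image_vertex_inj[of x y] visible[of x] visible[of y] by simp
  qed
  moreover have "image_vertex ` (verts G - {u}) \<subseteq> verts H"
  proof
    fix z assume "z \<in> image_vertex ` (verts G - {u})"
    then obtain x where "x \<in> verts G" "x \<noteq> u" "z = image_vertex x" by auto
    then show "z \<in> verts H" using image_vertex_verts visible by simp
  qed
  ultimately have bij: "bij_betw image_vertex (verts G - {u}) (verts H)"
    using surj by (simp add: bij_betw_def subset_antisym)
  have ends: "ends H e = image_vertex ` (ends G e - {u})" if e: "e \<in> edges G" for e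
  proof
    show "image_vertex ` (ends G e - {u}) \<subseteq> ends H e"
    proof
      fix z assume "z \<in> image_vertex ` (ends G e - {u})"
      then obtain x where "x \<in> ends G e" "x \<noteq> u" "z = image_vertex x" by auto
      then show "z \<in> ends H e" using image_vertex_in_ends[OF _ _ e, of x] visible[of x] ends_G[OF e] by auto
    qed
    show "ends H e \<subseteq> image_vertex ` (ends G e - {u})"
    proof
      fix z assume z: "z \<in> ends H e"
      then obtain y where "y \<in> verts G - {u}" "z = image_vertex y" using surj ends_H[OF e] by blast
      then show "z \<in> image_vertex ` (ends G e - {u})"
        using image_vertex_in_ends[OF _ _ e, of y] visible[of y] z by auto
    qed
  qed
  have B: "verts ?B = verts G - {u}" "edges ?B = edges G" by (auto simp: curled_graph_def)
  have "same_graph H ?B"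
    using bij ends ends_B
    by (intro same_graphI[of _ _ image_vertex]) (simp_all add: B Diff_mono ends_G)
  moreover have cyc: "cycle H C \<longleftrightarrow> cycle ?B C" for C
    using bij ends ends_B
    by (intro cycle_rename_iff[of _ _ image_vertex]) (simp_all add: B Diff_mono ends_G)
  \<comment> \<open>A cycle with an edge at \<open>u\<close> is that loop alone, hence odd. All
    other cycles lie in the balanced part \<open>G - u\<close>.\<close>
  have "C \<in> balanced_cycles \<Omega>" if C: "cycle H C" "even (card (C \<inter> star G u))" for C
  proof (cases "C \<inter> star G u = {}")
    case True
    then show ?thesis
      using hidden_balanced[OF assms(1) C(1)] subset_avoiding cycle_edges[OF C(1)] by simp
  next
    case False
    then obtain e where e: "e \<in> C" "e \<in> edges G" "u \<in> ends G e" by (auto simp: star_def)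
    obtain x where x: "x \<in> N" "ends G e = {u, x}" using edge_u[OF e(2,3)] by auto
    then have "ends H e = {image_vertex x}" using ends[OF e(2)] N by auto
    then have "C = {e}" by (rule cycle_with_loop[OF C(1) e(1)])
    then have "C \<inter> star G u = {e}" using e by (auto simp: star_def)
    then show ?thesis using C(2) by simp
  qed
  then have "balanced_cycles \<Omega> = balanced_cycles (signed_graph ?B {e \<in> edges G. u \<in> ends G e})"
    by (rule balanced_cycles_signed[OF cyc])
  ultimately have "same_biased_graph \<Omega> (signed_graph ?B {e \<in> edges G. u \<in> ends G e})"
    by (simp add: same_biased_graph_def signed_graph_def)
  then show ?thesis
    unfolding simple_curling_of_def using data
    by (intro exI[of _ u] exI[of _ k] exI[of _ vs] exI[of _ Hs]) (auto simp: Hs_def)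
qed

text \<open>The vertex \<open>v\<close> has a match \<open>z\<close> in \<open>G - u\<close>, and
  \<open>u\<close> has a match \<open>z'\<close> in \<open>G - v\<close>. Together with
  \<open>z\<close>, the images of the other vertices exhaust \<Omega>, and \<open>z'\<close> is none
  of these images; so \<open>z' = z\<close>, the vertex of the pinch.\<close>

lemma pinch_case:
  assumes "hidden u" "hidden v" "u \<noteq> v" "\<And>x. hidden x \<Longrightarrow> x = u \<or> x = v"
  shows "pinch_of \<Omega> G"
proof -
  have uv: "u \<in> verts G" "v \<in> verts G" using assms(1,2) by (auto simp: hidden_def)
  have visible: "\<not> hidden x" if "x \<noteq> u" "x \<noteq> v" for x using assms(4) that by blast
  \<comment> \<open>Here \<open>a\<close> is the deleted and \<open>b\<close> the remaining hidden
    vertex; the claim is applied to both orders of \<open>u\<close> and \<open>v\<close>.\<close>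
  have key: "\<exists>z. matches (avoiding G {a}) b z \<and>
      (\<forall>e\<in>avoiding G {a}. \<forall>x. ends G e = {b, x} \<longrightarrow> ends H e = {z, image_vertex x}) \<and>
      (\<forall>x\<in>verts G - {a, b}. image_vertex x \<noteq> z)"
    if ab: "hidden a" "b \<in> verts G" "a \<noteq> b" "{a, b} = {u, v}" for a b
  proof -
    obtain z where z: "matches (avoiding G {a}) b z" using hidden_matching[OF ab(1,2)] ab(3) by auto
    have vis: "\<not> hidden x" if "x \<noteq> a" "x \<noteq> b" for x using visible that ab(4) by (metis insert_iff singletonD)
    have ne: "image_vertex x \<noteq> z" if x: "x \<in> verts G - {a, b}" for x
    proof
      assume eq: "image_vertex x = z"
      have "matches (avoiding G {a}) x z"
        using image_vertex_matches[of x] vis x eq matches_mono[OF _ avoiding_subset] by auto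
      then show False using matches_inj[OF _ z, of x] x by auto
    qed
    have "ends H e = {z, image_vertex x}" if e: "e \<in> avoiding G {a}" "ends G e = {b, x}" for e x
    proof -
      have eE: "e \<in> edges G" using e by (auto simp: avoiding_def)
      then have x: "x \<in> verts G - {a, b}"
        using four_connected_edge_at[OF four eE, of b] e
        by (auto simp: avoiding_def doubleton_eq_iff)
      have "image_vertex x \<in> ends H e"
        using image_vertex_in_ends[OF _ _ eE, of x] x vis e by auto
      moreover have "z \<in> ends H e" using z e by (auto simp: matches_def)
      ultimately show ?thesis using ends_H_eq[OF eE] ne[OF x] by metis
    qed
    then show ?thesis using z ne by blast
  qed
  obtain z where z: "matches (avoiding G {u}) v z"
    "\<And>e x. e \<in> avoiding G {u} \<Longrightarrow> ends G e = {v, x} \<Longrightarrow> ends H e = {z, image_vertex x}"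
    "\<And>x. x \<in> verts G - {u, v} \<Longrightarrow> image_vertex x \<noteq> z"
    using key[OF assms(1) uv(2) assms(3) refl] by blast
  obtain z' where z': "matches (avoiding G {v}) u z'"
    "\<And>e x. e \<in> avoiding G {v} \<Longrightarrow> ends G e = {u, x} \<Longrightarrow> ends H e = {z', image_vertex x}"
    "\<And>x. x \<in> verts G - {v, u} \<Longrightarrow> image_vertex x \<noteq> z'"
    using key[OF assms(2) uv(1) assms(3)[symmetric] insert_commute] by blast
  have vis_ends: "ends H e = image_vertex ` ends G e" if "e \<in> avoiding G {u, v}" for e
    using that by (intro ends_H_visible) (auto simp: avoiding_def dest: assms(4))
  have edge_v: "e \<in> avoiding G {u, v} \<or> (\<exists>x\<in>verts G - {u, v}. ends G e = {v, x})"
    if e: "e \<in> avoiding G {u}" for e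
  proof (cases "v \<in> ends G e")
    case True
    have "e \<in> edges G" using e by (auto simp: avoiding_def)
    then obtain x where "ends G e = {v, x}" "v \<noteq> x" "x \<in> verts G"
      using four_connected_edge_at[OF four _ True] by metis
    then show ?thesis using e by (auto simp: avoiding_def)
  qed (use e in \<open>auto simp: avoiding_def\<close>)
  have covers: "y = z \<or> y \<in> image_vertex ` (verts G - {u, v})" if y: "y \<in> verts H" for y
  proof -
    obtain e where e: "e \<in> avoiding G {u}" "y \<in> ends H e" using hidden_spanning[OF assms(1) y] .
    from edge_v[OF e(1)] show ?thesis
    proof
      assume "e \<in> avoiding G {u, v}"
      then show ?thesis using vis_ends e(2) ends_G[of e] by (auto simp: avoiding_def)
    next
      assume "\<exists>x\<in>verts G - {u, v}. ends G e = {v, x}"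
      then show ?thesis using z(2)[OF e(1)] e(2) by auto
    qed
  qed
  obtain e0 where e0: "e0 \<in> avoiding G {v}" "u \<in> ends G e0"
    using four_connected_star_avoiding[OF four, of "{v}" u] uv assms(3) by auto
  then have "z' \<in> ends H e0" using z'(1) by (auto simp: matches_def)
  moreover have e0E: "e0 \<in> edges G" using e0 by (auto simp: avoiding_def)
  ultimately have z'H: "z' \<in> verts H" using ends_H by blast
  then have zz: "z' = z" using covers z'(3) by blast
  define h where "h x = (if x = u \<or> x = v then z else image_vertex x)" for x
  have ends: "ends H e = h ` ends G e" if e: "e \<in> edges G" for e
  proof -
    consider "e \<in> avoiding G {u}" | "e \<in> avoiding G {v}" | "u \<in> ends G e" "v \<in> ends G e"
      using e by (auto simp: avoiding_def)
    then show ?thesis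
    proof cases
      case 1
      from edge_v[OF 1] show ?thesis
      proof
        assume "e \<in> avoiding G {u, v}"
        then show ?thesis using vis_ends by (auto simp: h_def avoiding_def)
      next
        assume "\<exists>x\<in>verts G - {u, v}. ends G e = {v, x}"
        then show ?thesis using z(2)[OF 1] by (auto simp: h_def)
      qed
    next
      case 2
      show ?thesis
      proof (cases "u \<in> ends G e")
        case True
        obtain x where x: "ends G e = {u, x}" "u \<noteq> x" "x \<in> verts G"
          using four_connected_edge_at[OF four e True] by metis
        then have "x \<noteq> v" using 2 by (auto simp: avoiding_def)
        then show ?thesis using z'(2)[OF 2 x(1)] x zz by (auto simp: h_def)
      next
        case False
        then have "e \<in> avoiding G {u, v}" using 2 by (auto simp: avoiding_def)
        then show ?thesis using vis_ends by (auto simp: h_def avoiding_def)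
      qed
    next
      case 3
      obtain y where y: "ends G e = {u, y}"
        using four_connected_edge_at[OF four e 3(1)] by metis
      then have uv_e: "ends G e = {u, v}" using 3 assms(3) by auto
      \<comment> \<open>The image of any other vertex is an end only of edges at that vertex, so an
        edge between \<open>u\<close> and \<open>v\<close> has \<open>z\<close> as its sole
        end.\<close>
      have "y = z" if "y \<in> ends H e" for y
      proof -
        have "y \<in> verts H" using that ends_H[OF e] by blast
        moreover have "image_vertex x \<notin> ends H e" if "x \<in> verts G - {u, v}" for x
          using image_vertex_in_ends[OF _ _ e, of x] visible that uv_e by auto
        ultimately show ?thesis using covers that by blast
      qed
      then have "ends H e = {z}" using ends_H[OF e] by blast
      then show ?thesis using uv_e by (auto simp: h_def)
    qed
  qed
  have "inj_on h (verts G - {v})"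
  proof (rule inj_onI)
    fix x y assume xy: "x \<in> verts G - {v}" "y \<in> verts G - {v}" "h x = h y"
    show "x = y"
    proof (cases "x = u \<or> y = u")
      case True
      then show ?thesis using xy z(3)[of x] z(3)[of y] by (auto simp: h_def split: if_splits)
    next
      case False
      then show ?thesis using xy image_vertex_inj[of x y] visible by (auto simp: h_def)
    qed
  qed
  moreover have "h ` (verts G - {v}) = verts H"
  proof
    show "h ` (verts G - {v}) \<subseteq> verts H"
      using z'H zz image_vertex_verts visible by (auto simp: h_def)
    show "verts H \<subseteq> h ` (verts G - {v})"
    proof
      fix y assume "y \<in> verts H"
      from covers[OF this] show "y \<in> h ` (verts G - {v})"
      proof
        assume "y = z"
        then have "y = h u" by (simp add: h_def)
        then show ?thesis using uv assms(3) by auto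
      next
        assume "y \<in> image_vertex ` (verts G - {u, v})"
        then obtain x where "x \<in> verts G - {u, v}" "y = h x" by (auto simp: h_def)
        then show ?thesis by auto
      qed
    qed
  qed
  ultimately have bij: "bij_betw h (verts G - {v}) (verts H)" by (simp add: bij_betw_def)
  let ?B = "identify_verts G u v"
  have B: "verts ?B = verts G - {v}" "edges ?B = edges G" by (auto simp: identify_verts_def)
  have ends_B: "ends ?B e \<subseteq> verts ?B" "ends H e = h ` ends ?B e" if e: "e \<in> edges G" for e
  proof -
    show "ends ?B e \<subseteq> verts ?B" using ends_G[OF e] uv assms(3) by (auto simp: identify_verts_def)
    have "h \<circ> (\<lambda>x. if x = v then u else x) = h" by (auto simp: h_def fun_eq_iff)
    then show "ends H e = h ` ends ?B e"
      unfolding ends[OF e] by (simp only: identify_verts_def mgraph.simps image_comp)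
  qed
  have "same_graph H ?B"
    by (rule same_graphI[of _ _ h]) (use B bij ends_B in auto)
  moreover have cyc: "cycle H C \<longleftrightarrow> cycle ?B C" for C
    by (rule cycle_rename_iff[of _ _ h]) (use B bij ends_B in auto)
  have "C \<in> balanced_cycles \<Omega>" if C: "cycle H C" "even (card (C \<inter> star G u))" for C
  proof (cases "C \<inter> star G u = {} \<or> C \<inter> star G v = {}")
    case True
    then show ?thesis
      using hidden_balanced[OF assms(1) C(1)] hidden_balanced[OF assms(2) C(1)]
        subset_avoiding cycle_edges[OF C(1)] by auto
  next
    case False
    have CE: "C \<subseteq> edges G" using cycle_edges[OF C(1)] by simp
    \<comment> \<open>A cycle meeting both stars is odd. An edge between \<open>u\<close> and
      \<open>v\<close> is a loop and forms the whole cycle; otherwise the two stars are disjoint on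
      \<open>C\<close> and split its at most two edges at \<open>z\<close>, one each.\<close>
    have "card (C \<inter> star G u) = 1"
    proof (cases "\<exists>e\<in>C. u \<in> ends G e \<and> v \<in> ends G e")
      case True
      then obtain e where e: "e \<in> C" "u \<in> ends G e" "v \<in> ends G e" by auto
      have eE: "e \<in> edges G" using e CE by auto
      obtain y where "ends G e = {u, y}"
        using four_connected_edge_at[OF four eE e(2)] by metis
      then have "ends G e = {u, v}" using e assms(3) by auto
      then have "ends H e = {z}" using ends[OF eE] by (auto simp: h_def)
      then have "C = {e}" by (rule cycle_with_loop[OF C(1) e(1)])
      then have "C \<inter> star G u = {e}" using e eE by (auto simp: star_def)
      then show ?thesis by simp
    next
      case no: False
      have "z \<in> ends H e" if "e \<in> edges G" "u \<in> ends G e \<or> v \<in> ends G e" for e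
        using ends[OF that(1)] that(2) by (auto simp: h_def image_iff)
      then have sub: "(C \<inter> star G u) \<union> (C \<inter> star G v) \<subseteq> {e \<in> C. z \<in> ends H e}"
        by (auto simp: star_def)
      have fin: "finite C"
        using CE four finite_subset unfolding four_connected_ge5_def graph_def by blast
      have "card ((C \<inter> star G u) \<union> (C \<inter> star G v)) \<le> 2"
        using card_mono[OF _ sub] fin cycle_degree_le[OF C(1), of z] by auto
      moreover have "(C \<inter> star G u) \<inter> (C \<inter> star G v) = {}" using no by (auto simp: star_def)
      then have "card ((C \<inter> star G u) \<union> (C \<inter> star G v)) = card (C \<inter> star G u) + card (C \<inter> star G v)"
        using fin by (intro card_Un_disjoint) auto
      moreover have "card (C \<inter> star G u) > 0" "card (C \<inter> star G v) > 0"
        using False fin by (auto simp: card_gt_0_iff)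
      ultimately show ?thesis by linarith
    qed
    then show ?thesis using C(2) by simp
  qed
  then have "balanced_cycles \<Omega> = balanced_cycles (signed_graph ?B {e \<in> edges G. u \<in> ends G e})"
    by (rule balanced_cycles_signed[OF cyc])
  ultimately have "same_biased_graph \<Omega> (signed_graph ?B {e \<in> edges G. u \<in> ends G e})"
    by (simp add: same_biased_graph_def signed_graph_def)
  then show ?thesis unfolding pinch_of_def using uv assms(3) by blast
qed

end

theorem corollary1p4:
  fixes G :: "('v, 'e) mgraph" and \<Omega> :: "('w, 'e) bgraph"
  assumes "four_connected_ge5 G"
    and "biased_graph \<Omega>"
    and "no_isolated_verts (ugraph \<Omega>)"
    and "frame_matroid \<Omega> = cycle_matroid G"
  shows "(balanced \<Omega> \<and> same_graph (ugraph \<Omega>) G) \<or> simple_curling_of \<Omega> G \<or> pinch_of \<Omega> G"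
proof -
  interpret graphic_frame G \<Omega> by unfold_locales (fact assms)+
  consider "\<And>u. \<not> hidden u" | u where "hidden u" "\<And>x. hidden x \<Longrightarrow> x = u"
    | u v where "hidden u" "hidden v" "u \<noteq> v" by blast
  then show ?thesis
  proof cases
    case 1
    then show ?thesis using balanced_case by blast
  next
    case (2 u)
    then show ?thesis using curling_case by blast
  next
    case (3 u v)
    then show ?thesis using pinch_case[OF 3] no_three_hidden[OF 3(1,2)] by blast
  qed
qed

end
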